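(* Let $U\subseteq\mathbb{R}$ be open and $f\in\mathcal{D}'(U)$. Suppose there is a closed null set $E\subset U$ such that (I) $\operatorname{sing\,supp}_{PF}f\subseteq E$, and (II) for each $t_0\in E$ there are an open neighborhood $V_{t_0}$ of $t_0$ and a local pseudomeasure $f_{t_0}$ on $V_{t_0}$ such that $f=(t-t_0)f_{t_0}$ on $V_{t_0}$. Then $\operatorname{sing\,supp}_{PF}f=\emptyset$, that is, $f$ is a local pseudofunction on $U$.
   Context: The Fourier transform is $\hat\varphi(t)=\int e^{-itx}\varphi(x)\,\mathrm{d}x$, extended to tempered distributions by duality. A tempered distribution $g$ is a pseudomeasure if $\hat g\in L^\infty(\mathbb{R})$, and a pseudofunction if moreover $\hat g(x)\to0$ as $|x|\to\infty$. A distribution on an open set $V$ is a local pseudofunction (local pseudomeasure) on $V$ if each point of $V$ has an open neighborhood on which it coincides with a pseudofunction (pseudomeasure). For $f\in\mathcal{D}'(U)$, $\operatorname{sing\,supp}_{PF}f$ is the complement in $U$ of the largest open subset of $U$ on which $f$ is a local pseudofunction. *)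

theory Defs
  imports "HOL-Analysis.Analysis"
begin

text \<open>Complex-valued functions of one real variable; distributions are modelled as
  complex-valued functionals on such functions, only their values on test functions matter.\<close>

type_synonym testfun = "real \<Rightarrow> complex"
type_synonym distr = "testfun \<Rightarrow> complex"

fun nderiv :: "nat \<Rightarrow> testfun \<Rightarrow> testfun" where
  "nderiv 0 f = f"
| "nderiv (Suc k) f = (\<lambda>x. vector_derivative (nderiv k f) (at x))"

definition smooth_fun :: "testfun \<Rightarrow> bool" where
  "smooth_fun f \<longleftrightarrow> (\<forall>k x. (nderiv k f has_vector_derivative nderiv (Suc k) f x) (at x))"

definition tsupport :: "testfun \<Rightarrow> real set" where
  "tsupport f = closure {x. f x \<noteq> 0}"

definition test_funs :: "real set \<Rightarrow> testfun set" where
  "test_funs U = {\<phi>. smooth_fun \<phi> \<and> compact (tsupport \<phi>) \<and> tsupport \<phi> \<subseteq> U}"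

definition supnorm_deriv :: "nat \<Rightarrow> testfun \<Rightarrow> real" where
  "supnorm_deriv k \<phi> = (SUP x. norm (nderiv k \<phi> x))"

definition linear_on :: "testfun set \<Rightarrow> distr \<Rightarrow> bool" where
  "linear_on S T \<longleftrightarrow> (\<forall>\<phi>\<in>S. \<forall>\<psi>\<in>S. \<forall>a b::complex.
      T (\<lambda>x. a * \<phi> x + b * \<psi> x) = a * T \<phi> + b * T \<psi>)"

definition distribution :: "real set \<Rightarrow> distr \<Rightarrow> bool" where
  "distribution U T \<longleftrightarrow> linear_on (test_funs U) T \<and>
     (\<forall>K. compact K \<and> K \<subseteq> U \<longrightarrow> (\<exists>C N. \<forall>\<phi>\<in>test_funs U. tsupport \<phi> \<subseteq> K \<longrightarrow>
         norm (T \<phi>) \<le> C * (\<Sum>k\<le>N. supnorm_deriv k \<phi>)))"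

definition schwartz :: "testfun set" where
  "schwartz = {\<phi>. smooth_fun \<phi> \<and>
      (\<forall>m k. bounded (range (\<lambda>x. complex_of_real x ^ m * nderiv k \<phi> x)))}"

definition schwartz_seminorm :: "nat \<Rightarrow> nat \<Rightarrow> testfun \<Rightarrow> real" where
  "schwartz_seminorm m k \<phi> = (SUP x. norm (complex_of_real x ^ m * nderiv k \<phi> x))"

definition tempered :: "distr \<Rightarrow> bool" where
  "tempered T \<longleftrightarrow> linear_on schwartz T \<and>
     (\<exists>C N. \<forall>\<phi>\<in>schwartz. norm (T \<phi>) \<le> C * (\<Sum>m\<le>N. \<Sum>k\<le>N. schwartz_seminorm m k \<phi>))"

definition fourier :: "testfun \<Rightarrow> testfun" where
  "fourier \<phi> = (\<lambda>t. LINT x|lborel. exp (- \<i> * complex_of_real (t * x)) * \<phi> x)"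

definition fourier_distr :: "distr \<Rightarrow> distr" where
  "fourier_distr g = (\<lambda>\<phi>. g (fourier \<phi>))"

definition fourier_is_fun :: "distr \<Rightarrow> testfun \<Rightarrow> bool" where
  "fourier_is_fun g F \<longleftrightarrow> F \<in> borel_measurable lborel \<and> bounded (range F) \<and>
     (\<forall>\<phi>\<in>schwartz. fourier_distr g \<phi> = (LINT x|lborel. F x * \<phi> x))"

definition pseudomeasure :: "distr \<Rightarrow> bool" where
  "pseudomeasure g \<longleftrightarrow> tempered g \<and> (\<exists>F. fourier_is_fun g F)"

definition pseudofunction :: "distr \<Rightarrow> bool" where
  "pseudofunction g \<longleftrightarrow> tempered g \<and> (\<exists>F. fourier_is_fun g F \<and> (F \<longlongrightarrow> 0) at_infinity)"

definition local_pseudofunction :: "real set \<Rightarrow> distr \<Rightarrow> bool" where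
  "local_pseudofunction V f \<longleftrightarrow> distribution V f \<and>
     (\<forall>x\<in>V. \<exists>W. open W \<and> x \<in> W \<and> W \<subseteq> V \<and>
        (\<exists>g. pseudofunction g \<and> (\<forall>\<phi>\<in>test_funs W. f \<phi> = g \<phi>)))"

definition local_pseudomeasure :: "real set \<Rightarrow> distr \<Rightarrow> bool" where
  "local_pseudomeasure V f \<longleftrightarrow> distribution V f \<and>
     (\<forall>x\<in>V. \<exists>W. open W \<and> x \<in> W \<and> W \<subseteq> V \<and>
        (\<exists>g. pseudomeasure g \<and> (\<forall>\<phi>\<in>test_funs W. f \<phi> = g \<phi>)))"

definition sing_supp_PF :: "real set \<Rightarrow> distr \<Rightarrow> real set" where
  "sing_supp_PF U f = U - \<Union>{V. open V \<and> V \<subseteq> U \<and> local_pseudofunction V f}"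

end

(* Call W(p) the L^1 norm of the Fourier transform of p. If f = (t - t0) g near t0 with a
   pseudomeasure g, then |f(p)| <= n W((t - t0) p) for some n and all p supported within 1/(n+1)
   of t0. By Baire, on the locally closed set S = sing supp f this holds with one n for all t0 in a
   relatively open portion of S around some t1. Let k be a cutoff near t1. Then k f = ((t - t1) k) g
   is a pseudomeasure whose Fourier transform is F(h) = f(k e_h) with e_h(t) = exp(-iht). Split k by
   a partition of unity of width d: the pieces supported off S contribute o(1) as |h| tends to
   infinity, and a piece close to a point t0 of S contributes at most n W((t - t0) k_j) = O(d),
   because W is invariant under dilation, translation and modulation. As S is null, d times the
   number of such pieces tends to 0 with d. So F vanishes at infinity and t1 is not in S. *)
theory Submission
  imports Defs "HOL-Probability.Characteristic_Functions" "HOL-Probability.Sinc_Integral"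
begin

section \<open>Smooth functions\<close>

text \<open>Hypothesis (II) gives a constant and a neighborhood for each t0 separately, while the
  sum over the pieces near S involves many t0 at once. Counting pieces is of use only under one
  common constant, hence the appeal to category. The argument runs on S and not on E: a piece that
  misses S is harmless by definition, and the portion has to meet S for a contradiction. About 1/d
  pieces, each contributing O(d), give mere boundedness; nullness turns this into smallness. As W
  ignores modulation, the estimate near S does not see h, which fixes the order of the limits: d is
  chosen for a given error, and then |h| grows in a finite sum. W is the right norm for two reasons.
  A functional with bounded Fourier transform is bounded by W, and W is submultiplicative, so a
  fixed cutoff costs only a constant. Both rest on Fourier inversion for test functions, since a
  pseudomeasure is described by its values on Fourier transforms.\<close>

text \<open>Finite-order differentiability as a recursive predicate: closure under products and inverses then follows by induction on the order, without the Leibniz formula.\<close>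

fun cdiff :: "nat \<Rightarrow> testfun \<Rightarrow> bool" where
  "cdiff 0 f = True"
| "cdiff (Suc k) f = (\<exists>f'. (\<forall>x. (f has_vector_derivative f' x) (at x)) \<and> cdiff k f')"

text \<open>\<open>nderiv\<close> adds a derivative on the outside, \<open>cdiff\<close> peels one
  off on the inside; this exchanges the two recursions.\<close>

lemma nderiv_Suc_shift: "nderiv (Suc k) f = nderiv k (nderiv 1 f)"
  by (induction k) auto

lemma cdiff_SucI:
  assumes "\<And>x. (f has_vector_derivative f' x) (at x)" "cdiff k f'"
  shows "cdiff (Suc k) f"
  using assms by auto

lemma cdiff_Suc_imp_has_vector_derivative:
  "cdiff (Suc k) f \<Longrightarrow> (nderiv k f has_vector_derivative nderiv (Suc k) f x) (at x)"
proof (induction k arbitrary: f)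
  case 0
  then show ?case by auto (metis vector_derivative_at)
next
  case (Suc k)
  from Suc.prems obtain f' where f': "\<And>x. (f has_vector_derivative f' x) (at x)" "cdiff (Suc k) f'"
    by (metis cdiff.simps(2))
  have "nderiv 1 f = f'" using f'(1) by (auto simp: vector_derivative_at)
  then show ?case
    using Suc.IH[OF f'(2)] nderiv_Suc_shift[of k f] nderiv_Suc_shift[of "Suc k" f] by simp
qed

lemma smooth_fun_iff_cdiff: "smooth_fun f \<longleftrightarrow> (\<forall>k. cdiff k f)"
proof
  assume s: "smooth_fun f"
  \<comment> \<open>The claim is generalised to every derivative \<open>j\<close>, since the
    induction step passes to the next one.\<close>
  have "cdiff k (nderiv j f)" for k j
  proof (induction k arbitrary: j)
    case (Suc k)
    then show ?case
      using s unfolding smooth_fun_def by (blast intro: cdiff_SucI)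
  qed simp
  from this[of _ 0] show "\<forall>k. cdiff k f" by simp
next
  assume "\<forall>k. cdiff k f"
  then show "smooth_fun f"
    unfolding smooth_fun_def using cdiff_Suc_imp_has_vector_derivative by blast
qed

lemma cdiff_Suc_imp: "cdiff (Suc k) f \<Longrightarrow> cdiff k f"
  by (induction k arbitrary: f) (simp, metis cdiff.simps(2))

lemma cdiff_const: "cdiff k (\<lambda>_. c)"
proof (induction k arbitrary: c)
  case (Suc k)
  then show ?case by (intro cdiff_SucI[of _ "\<lambda>_. 0"]) auto
qed simp

lemma cdiff_add: "cdiff k f \<Longrightarrow> cdiff k g \<Longrightarrow> cdiff k (\<lambda>x. f x + g x)"
proof (induction k arbitrary: f g)
  case (Suc k)
  then obtain f' g' where "\<And>x. (f has_vector_derivative f' x) (at x)" "cdiff k f'"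
    "\<And>x. (g has_vector_derivative g' x) (at x)" "cdiff k g'" by auto
  then show ?case
    using Suc.IH by (intro cdiff_SucI[of _ "\<lambda>x. f' x + g' x"]) (auto intro: has_vector_derivative_add)
qed simp

lemma cdiff_mult: "cdiff k f \<Longrightarrow> cdiff k g \<Longrightarrow> cdiff k (\<lambda>x. f x * g x)"
proof (induction k arbitrary: f g)
  case (Suc k)
  then obtain f' g' where d: "\<And>x. (f has_vector_derivative f' x) (at x)" "cdiff k f'"
    "\<And>x. (g has_vector_derivative g' x) (at x)" "cdiff k g'" by auto
  have "cdiff k f" "cdiff k g" using Suc.prems cdiff_Suc_imp by blast+
  then show ?case
    using d Suc.IH
    by (intro cdiff_SucI[of _ "\<lambda>x. f x * g' x + f' x * g x"])
      (auto intro: has_vector_derivative_mult cdiff_add)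
qed simp

lemma cdiff_of_real_affine: "cdiff k (\<lambda>x. complex_of_real (a * x + b))"
proof (cases k)
  case (Suc n)
  have "((\<lambda>x. complex_of_real (a * x + b)) has_vector_derivative complex_of_real a) (at x)" for x
    by (auto intro!: derivative_eq_intros has_vector_derivative_real_field
          simp: has_vector_derivative_def has_field_derivative_def scaleR_conv_of_real)
  with Suc show ?thesis using cdiff_SucI[OF _ cdiff_const] by blast
qed simp

lemma cdiff_affine: "cdiff k f \<Longrightarrow> cdiff k (\<lambda>x. f (a * x + b))"
proof (induction k arbitrary: f)
  case (Suc k)
  then obtain f' where d: "\<And>x. (f has_vector_derivative f' x) (at x)" "cdiff k f'" by auto
  have "((\<lambda>x. f (a * x + b)) has_vector_derivative of_real a * f' (a * x + b)) (at x)" for x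
  proof -
    have "((\<lambda>x. a * x + b) has_vector_derivative a) (at x)"
      by (auto intro!: derivative_eq_intros simp: has_vector_derivative_def)
    from vector_diff_chain_at[OF this d(1)] show ?thesis
      by (simp add: o_def scaleR_conv_of_real)
  qed
  then show ?case
    by (rule cdiff_SucI[OF _ cdiff_mult[OF cdiff_const Suc.IH[OF d(2)]]])
qed simp

lemma cdiff_exp_linear: "cdiff k (\<lambda>x. exp (c * complex_of_real x))"
proof (induction k)
  case (Suc k)
  have "((\<lambda>x. exp (c * complex_of_real x)) has_vector_derivative c * exp (c * complex_of_real x)) (at x)" for x
    by (rule has_vector_derivative_real_field) (auto intro!: derivative_eq_intros)
  then show ?case using Suc by (rule cdiff_SucI[OF _ cdiff_mult[OF cdiff_const]])
qed simp

lemma cdiff_inverse: "cdiff k f \<Longrightarrow> (\<And>x. f x \<noteq> 0) \<Longrightarrow> cdiff k (\<lambda>x. inverse (f x))"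
proof (induction k arbitrary: f)
  case (Suc k)
  then obtain f' where d: "\<And>x. (f has_vector_derivative f' x) (at x)" "cdiff k f'" by auto
  have i: "cdiff k (\<lambda>x. inverse (f x))" using Suc cdiff_Suc_imp by blast
  have "((\<lambda>x. inverse (f x)) has_vector_derivative - (inverse (f x) * f' x * inverse (f x))) (at x)" for x
    using Deriv.has_derivative_inverse[OF Suc.prems(2) d(1)[of x, unfolded has_vector_derivative_def]]
    by (simp add: has_vector_derivative_def)
  moreover have "cdiff k (\<lambda>x. - (inverse (f x) * f' x * inverse (f x)))"
    using cdiff_mult[OF cdiff_const[of k "-1"] cdiff_mult[OF cdiff_mult[OF i d(2)] i]] by simp
  ultimately show ?case by (rule cdiff_SucI)
qed simp

lemma smooth_const: "smooth_fun (\<lambda>_. c)"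
  and smooth_add: "smooth_fun f \<Longrightarrow> smooth_fun g \<Longrightarrow> smooth_fun (\<lambda>x. f x + g x)"
  and smooth_mult: "smooth_fun f \<Longrightarrow> smooth_fun g \<Longrightarrow> smooth_fun (\<lambda>x. f x * g x)"
  and smooth_of_real_affine: "smooth_fun (\<lambda>x. complex_of_real (a * x + b))"
  and smooth_affine: "smooth_fun f \<Longrightarrow> smooth_fun (\<lambda>x. f (a * x + b))"
  and smooth_exp_linear: "smooth_fun (\<lambda>x. exp (e * complex_of_real x))"
  and smooth_inverse: "smooth_fun f \<Longrightarrow> (\<And>x. f x \<noteq> 0) \<Longrightarrow> smooth_fun (\<lambda>x. inverse (f x))"
  unfolding smooth_fun_iff_cdiff
  by (blast intro: cdiff_const cdiff_add cdiff_mult cdiff_of_real_affine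
        cdiff_affine cdiff_exp_linear cdiff_inverse)+

lemma smooth_sub_of_real: "smooth_fun (\<lambda>x. complex_of_real (x - a))"
  using smooth_of_real_affine[of 1 "-a"] by simp

lemma smooth_diff: "smooth_fun f \<Longrightarrow> smooth_fun g \<Longrightarrow> smooth_fun (\<lambda>x. f x - g x)"
  using smooth_add[OF _ smooth_mult[OF smooth_const[of "-1"]], of f g] by simp

lemma nderiv_has_vector_derivative:
  "smooth_fun f \<Longrightarrow> (nderiv k f has_vector_derivative nderiv (Suc k) f x) (at x)"
  by (simp add: smooth_fun_def)

text \<open>Serves to read off all higher derivatives in closed form once a sequence of candidates
  is known, as for the Fourier transform.\<close>

lemma smooth_funI_sequence:
  assumes "D 0 = f" "\<And>k x. (D k has_vector_derivative D (Suc k) x) (at x)"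
  shows "smooth_fun f" "nderiv k f = D k"
proof -
  show *: "nderiv k f = D k" for k
    by (induction k) (use assms in \<open>auto simp: vector_derivative_at\<close>)
  show "smooth_fun f" unfolding smooth_fun_def using assms(2) * by presburger
qed

lemma smooth_nderiv: "smooth_fun f \<Longrightarrow> smooth_fun (nderiv j f)"
  by (rule smooth_funI_sequence(1)[of "\<lambda>k. nderiv (k + j) f"]) (auto simp: smooth_fun_def)

lemma smooth_continuous_nderiv: "smooth_fun f \<Longrightarrow> continuous_on A (nderiv k f)"
  by (meson continuous_at_imp_continuous_on has_vector_derivative_continuous smooth_fun_def)

lemma smooth_continuous: "smooth_fun f \<Longrightarrow> continuous_on A f"
  using smooth_continuous_nderiv[of f A 0] by simp

section \<open>A smooth step built from exp(-1/t)\<close>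

definition flat_exp :: "nat \<Rightarrow> real \<Rightarrow> real" where
  "flat_exp n t = (if t > 0 then inverse t ^ n * exp (- inverse t) else 0)"

text \<open>The powers of 1/t belong to the family so that differentiation stays in its linear span;
  smoothness of the classical case n = 0 then follows by one induction over all n.\<close>

lemma flat_exp_has_derivative:
  "(flat_exp n has_real_derivative flat_exp (n + 2) t - real n * flat_exp (n + 1) t) (at t)"
proof -
  consider "t > 0" | "t < 0" | "t = 0" by linarith
  then show ?thesis
  proof cases
    case 1
    have d: "((\<lambda>t. inverse t ^ n * exp (- inverse t)) has_real_derivative
        inverse t ^ n * (exp (- inverse t) * (inverse t)\<^sup>2) +
        real n * inverse t ^ (n - 1) * (- (inverse t)\<^sup>2) * exp (- inverse t)) (at t)"
      using 1 by (auto intro!: derivative_eq_intros simp: power2_eq_square)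
    \<comment> \<open>The exponent \<open>n - 1\<close> is truncated; at n = 0 the factor
      \<open>real n\<close> makes both sides vanish.\<close>
    have aux: "real n * inverse t ^ (n - 1) * (- (inverse t)\<^sup>2) = - real n * inverse t ^ (n + 1)"
      by (cases n) (auto simp: power2_eq_square algebra_simps)
    from aux have "inverse t ^ n * (exp (- inverse t) * (inverse t)\<^sup>2) +
        real n * inverse t ^ (n - 1) * (- (inverse t)\<^sup>2) * exp (- inverse t)
        = flat_exp (n + 2) t - real n * flat_exp (n + 1) t"
      using 1 by (simp add: flat_exp_def power_add power2_eq_square)
    with d have "((\<lambda>t. inverse t ^ n * exp (- inverse t)) has_real_derivative
        flat_exp (n + 2) t - real n * flat_exp (n + 1) t) (at t)" by simp
    then show ?thesis
      by (rule has_field_derivative_transform_within_open[where S="{0<..}"]) (use 1 in \<open>auto simp: flat_exp_def\<close>)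
  next
    case 2
    have "((\<lambda>t. 0) has_real_derivative flat_exp (n + 2) t - real n * flat_exp (n + 1) t) (at t)"
      using 2 by (simp add: flat_exp_def)
    then show ?thesis
      by (rule has_field_derivative_transform_within_open[where S="{..<0}"]) (use 2 in \<open>auto simp: flat_exp_def\<close>)
  next
    case 3
    \<comment> \<open>With x = 1/h the right difference quotient at 0 becomes x^(n+1) / exp
      x.\<close>
    have "((\<lambda>x::real. x ^ (n+1) / exp x) \<longlongrightarrow> 0) at_top" by (rule tendsto_power_div_exp_0)
    then have "((\<lambda>h. inverse h ^ (n+1) / exp (inverse h)) \<longlongrightarrow> 0) (at_right (0::real))"
      using filterlim_compose[OF _ filterlim_inverse_at_top_right] by blast
    then have r: "((\<lambda>h. (flat_exp n h - flat_exp n 0) / (h - 0)) \<longlongrightarrow> 0) (at_right (0::real))"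
    proof (rule Lim_transform_eventually)
      show "\<forall>\<^sub>F h in at_right (0::real). inverse h ^ (n+1) / exp (inverse h)
          = (flat_exp n h - flat_exp n 0) / (h - 0)"
        by (auto simp: eventually_at_filter flat_exp_def exp_minus field_simps intro!: always_eventually)
    qed
    have l: "((\<lambda>h. (flat_exp n h - flat_exp n 0) / (h - 0)) \<longlongrightarrow> 0) (at_left (0::real))"
      by (rule tendsto_eventually) (auto simp: eventually_at_filter flat_exp_def)
    have "((\<lambda>h. (flat_exp n h - flat_exp n 0) / (h - 0)) \<longlongrightarrow> 0) (at (0::real))"
      using l r filterlim_split_at_real by blast
    then have "(flat_exp n has_real_derivative 0) (at 0)" by (simp add: has_field_derivative_iff)
    then show ?thesis using 3 by (simp add: flat_exp_def)
  qed
qed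

lemma smooth_flat_exp: "smooth_fun (\<lambda>t. complex_of_real (flat_exp n t))"
proof -
  have "cdiff k (\<lambda>t. complex_of_real (flat_exp n t))" for k n
  proof (induction k arbitrary: n)
    case (Suc k)
    have "((\<lambda>t. complex_of_real (flat_exp n t)) has_vector_derivative
        (complex_of_real (flat_exp (n + 2) t) + (- of_nat n) * complex_of_real (flat_exp (n + 1) t))) (at t)" for t
      using has_vector_derivative_of_real[OF flat_exp_has_derivative[of n t]] by simp
    moreover have "cdiff k (\<lambda>t. complex_of_real (flat_exp (n + 2) t) + (- of_nat n) * complex_of_real (flat_exp (n + 1) t))"
      by (intro cdiff_add cdiff_mult cdiff_const Suc)
    ultimately show ?case by (rule cdiff_SucI)
  qed simp
  then show ?thesis by (simp add: smooth_fun_iff_cdiff)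
qed

definition smooth_step :: testfun where
  "smooth_step t = complex_of_real (flat_exp 0 t) * inverse (complex_of_real (flat_exp 0 t) + complex_of_real (flat_exp 0 (1 - t)))"

lemma smooth_step: "smooth_fun smooth_step"
  and smooth_step_eq_0: "t \<le> 0 \<Longrightarrow> smooth_step t = 0"
  and smooth_step_eq_1: "t \<ge> 1 \<Longrightarrow> smooth_step t = 1"
proof -
  \<comment> \<open>One of t and 1 - t is positive, so the denominator of \<open>smooth_step\<close>
    never vanishes.\<close>
  have pos: "flat_exp 0 t + flat_exp 0 (1 - t) > 0" for t by (auto simp: flat_exp_def add_pos_pos)
  have "smooth_fun (\<lambda>t. complex_of_real (flat_exp 0 ((-1) * t + 1)))"
    by (rule smooth_affine[OF smooth_flat_exp])
  then have s: "smooth_fun (\<lambda>t. complex_of_real (flat_exp 0 (1 - t)))" by simp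
  have nz: "complex_of_real (flat_exp 0 t) + complex_of_real (flat_exp 0 (1 - t)) \<noteq> 0" for t
    using pos[of t] by (metis less_irrefl of_real_add of_real_eq_0_iff)
  show "smooth_fun smooth_step"
    unfolding smooth_step_def[abs_def]
    by (intro smooth_mult smooth_flat_exp smooth_inverse smooth_add s nz)
  show "t \<le> 0 \<Longrightarrow> smooth_step t = 0" by (simp add: smooth_step_def flat_exp_def)
  show "t \<ge> 1 \<Longrightarrow> smooth_step t = 1" by (simp add: smooth_step_def flat_exp_def)
qed

section \<open>Test functions and cutoffs\<close>

lemma tsupport_nonzero: "f x \<noteq> 0 \<Longrightarrow> x \<in> tsupport f"
  unfolding tsupport_def by (rule subsetD[OF closure_subset]) simp

lemma tsupport_subsetI: "closed K \<Longrightarrow> (\<And>x. f x \<noteq> 0 \<Longrightarrow> x \<in> K) \<Longrightarrow> tsupport f \<subseteq> K"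
  unfolding tsupport_def by (intro closure_minimal) auto

lemma closed_tsupport: "closed (tsupport f)"
  by (simp add: tsupport_def)

lemma test_funsI:
  assumes "smooth_fun f" "compact K" "K \<subseteq> U" "\<And>x. f x \<noteq> 0 \<Longrightarrow> x \<in> K"
  shows "f \<in> test_funs U"
proof -
  have "tsupport f \<subseteq> K" using assms by (intro tsupport_subsetI) (auto simp: compact_imp_closed)
  moreover have "compact (tsupport f)"
    using calculation assms(2) closed_tsupport compact_Int_closed[of K "tsupport f"] by (simp add: Int_absorb1)
  ultimately show ?thesis using assms by (auto simp: test_funs_def)
qed

lemma test_funsD:
  assumes "f \<in> test_funs U"
  shows "smooth_fun f" "compact (tsupport f)" "tsupport f \<subseteq> U"
  using assms by (auto simp: test_funs_def)

lemma test_funs_mono: "f \<in> test_funs U \<Longrightarrow> U \<subseteq> V \<Longrightarrow> f \<in> test_funs V"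
  by (auto simp: test_funs_def)

lemma test_funs_UNIV: "f \<in> test_funs U \<Longrightarrow> f \<in> test_funs UNIV"
  by (auto simp: test_funs_def)

lemma test_funs_mult:
  assumes "f \<in> test_funs U" "smooth_fun g"
  shows "(\<lambda>x. f x * g x) \<in> test_funs U" "(\<lambda>x. g x * f x) \<in> test_funs U"
proof -
  note f = test_funsD[OF assms(1)]
  show "(\<lambda>x. f x * g x) \<in> test_funs U"
    by (rule test_funsI[OF smooth_mult[OF f(1) assms(2)] f(2,3)]) (auto intro: tsupport_nonzero)
  then show "(\<lambda>x. g x * f x) \<in> test_funs U" by (simp add: mult.commute)
qed

lemma test_funs_cmult: "f \<in> test_funs U \<Longrightarrow> (\<lambda>x. c * f x) \<in> test_funs U"
  using test_funs_mult(2)[of f U "\<lambda>_. c"] smooth_const by blast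

lemma test_funs_add:
  assumes "f \<in> test_funs U" "g \<in> test_funs U"
  shows "(\<lambda>x. f x + g x) \<in> test_funs U"
proof (rule test_funsI)
  show "smooth_fun (\<lambda>x. f x + g x)" using assms smooth_add test_funsD by blast
  show "compact (tsupport f \<union> tsupport g)" "tsupport f \<union> tsupport g \<subseteq> U"
    using assms test_funsD by auto
  show "x \<in> tsupport f \<union> tsupport g" if "f x + g x \<noteq> 0" for x
    using that by (metis UnI1 UnI2 add_0 tsupport_nonzero)
qed

lemma test_funs_zero: "(\<lambda>_. 0) \<in> test_funs U"
  by (rule test_funsI[OF smooth_const compact_empty]) auto

lemma test_funs_sum:
  "(\<And>i. i \<in> I \<Longrightarrow> f i \<in> test_funs U) \<Longrightarrow> (\<lambda>x. \<Sum>i\<in>I. f i x) \<in> test_funs U"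
proof (induction I rule: infinite_finite_induct)
  case (insert i I)
  have "f i \<in> test_funs U" "(\<lambda>x. \<Sum>i\<in>I. f i x) \<in> test_funs U"
    using insert.prems by (simp, intro insert.IH) simp
  from test_funs_add[OF this] show ?case using insert.hyps by simp
qed (simp_all add: test_funs_zero)

lemma test_funs_uminus_arg:
  assumes "f \<in> test_funs UNIV"
  shows "(\<lambda>x. f (- x)) \<in> test_funs UNIV"
proof (rule test_funsI)
  show "smooth_fun (\<lambda>x. f (- x))"
    using smooth_affine[OF test_funsD(1)[OF assms], of "-1" 0] by simp
  show "compact (uminus ` tsupport f)"
    using test_funsD(2)[OF assms] by (rule compact_negations)
  show "x \<in> uminus ` tsupport f" if "f (- x) \<noteq> 0" for x
    using tsupport_nonzero[of f, OF that] by (metis image_eqI minus_minus)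
qed auto

lemma nderiv_eq_0_outside_tsupport:
  assumes "x \<notin> tsupport f"
  shows "nderiv k f x = 0"
  using assms
proof (induction k arbitrary: x)
  case 0
  then show ?case using tsupport_nonzero[of f x] by auto
next
  case (Suc k)
  have "((\<lambda>_. 0) has_vector_derivative 0) (at x)" by simp
  then have "(nderiv k f has_vector_derivative 0) (at x)"
    by (rule has_vector_derivative_transform_within_open[of _ _ _ "- tsupport f"])
      (use Suc closed_tsupport in \<open>auto simp: open_Compl\<close>)
  then show ?case by (simp add: vector_derivative_at)
qed

lemma test_funs_nderiv:
  assumes "f \<in> test_funs U"
  shows "nderiv k f \<in> test_funs U"
  by (rule test_funsI[of _ "tsupport f"])
    (use assms nderiv_eq_0_outside_tsupport in \<open>auto simp: test_funs_def intro: smooth_nderiv\<close>)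

lemma test_funs_continuous: "f \<in> test_funs U \<Longrightarrow> continuous_on A f"
  using smooth_continuous test_funsD(1) by blast

lemma test_funs_measurable: "f \<in> test_funs U \<Longrightarrow> f \<in> borel_measurable borel"
  using test_funs_continuous borel_measurable_continuous_onI by blast

lemma test_funs_interval:
  assumes "f \<in> test_funs U"
  obtains R where "R > 0" "\<And>x. \<bar>x\<bar> > R \<Longrightarrow> f x = 0"
proof -
  obtain R where R: "\<And>x. x \<in> tsupport f \<Longrightarrow> \<bar>x\<bar> \<le> R"
    using test_funsD(2)[OF assms] compact_imp_bounded by (metis bounded_real)
  show ?thesis
  proof (rule that[of "max R 1"])
    show "f x = 0" if "\<bar>x\<bar> > max R 1" for x
      using R[of x] tsupport_nonzero[of f x] that by auto
  qed auto
qed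

lemma test_funs_bounded:
  assumes "f \<in> test_funs U"
  obtains B where "B > 0" "\<And>x. norm (f x) \<le> B"
proof -
  have "compact (f ` tsupport f)"
    using assms by (intro compact_continuous_image test_funs_continuous test_funsD)
  then obtain B where B: "\<And>x. x \<in> tsupport f \<Longrightarrow> norm (f x) \<le> B"
    using compact_imp_bounded bounded_iff by (metis imageI)
  show ?thesis
  proof (rule that[of "max B 1"])
    show "norm (f x) \<le> max B 1" for x
      using B[of x] tsupport_nonzero[of f x] by (cases "f x = 0") auto
  qed auto
qed

lemma test_funs_integrable:
  assumes "f \<in> test_funs U"
  shows "integrable lborel f"
proof -
  obtain R where R: "\<And>x. \<bar>x\<bar> > R \<Longrightarrow> f x = 0" using test_funs_interval[OF assms] by metis
  have "set_integrable lborel {-R..R} f"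
    unfolding set_integrable_def
    by (rule borel_integrable_compact) (use test_funs_continuous[OF assms] in auto)
  moreover have "(\<lambda>x. indicator {-R..R} x *\<^sub>R f x) = f"
    using R by (force simp: indicator_def)
  ultimately show ?thesis by (simp add: set_integrable_def)
qed

lemma test_funs_bounded_weighted:
  assumes "f \<in> test_funs U" "smooth_fun g"
  shows "bounded (range (\<lambda>x. g x * f x))"
proof -
  obtain B where "\<And>x. norm (g x * f x) \<le> B"
    using test_funs_bounded[OF test_funs_mult(2)[OF assms]] by blast
  then show ?thesis unfolding bounded_iff by blast
qed

lemma smooth_of_real_power: "smooth_fun (\<lambda>x. complex_of_real x ^ m)"
proof (induction m)
  case (Suc m)
  have "smooth_fun (\<lambda>x. complex_of_real x)" using smooth_of_real_affine[of 1 0] by simp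
  from smooth_mult[OF this Suc] show ?case by simp
qed (simp add: smooth_const)

lemma test_funs_schwartz:
  assumes "f \<in> test_funs U"
  shows "f \<in> schwartz"
proof -
  have "bounded (range (\<lambda>x. complex_of_real x ^ m * nderiv k f x))" for m k
    by (rule test_funs_bounded_weighted[OF test_funs_nderiv[OF assms] smooth_of_real_power])
  then show ?thesis using test_funsD(1)[OF assms] by (simp add: schwartz_def)
qed

section \<open>Linear functionals on test functions\<close>

lemma distribution_linear_on: "distribution U T \<Longrightarrow> linear_on (test_funs U) T"
  by (simp add: distribution_def)

lemma linear_onD:
  "linear_on S T \<Longrightarrow> \<phi> \<in> S \<Longrightarrow> \<psi> \<in> S \<Longrightarrow> T (\<lambda>x. a * \<phi> x + b * \<psi> x) = a * T \<phi> + b * T \<psi>"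
  by (simp add: linear_on_def)

lemma linear_on_zero:
  assumes "linear_on (test_funs U) T"
  shows "T (\<lambda>_. 0) = 0"
  using linear_onD[OF assms test_funs_zero test_funs_zero, where a=0 and b=0] by simp

lemma linear_on_sum:
  assumes "linear_on (test_funs U) T" "\<And>i. i \<in> I \<Longrightarrow> f i \<in> test_funs U"
  shows "T (\<lambda>x. \<Sum>i\<in>I. f i x) = (\<Sum>i\<in>I. T (f i))"
  using assms(2)
proof (induction I rule: infinite_finite_induct)
  case (infinite A)
  then show ?case using linear_on_zero[OF assms(1)] by simp
next
  case empty
  then show ?case using linear_on_zero[OF assms(1)] by simp
next
  case (insert i I)
  have "(\<lambda>x. \<Sum>i\<in>I. f i x) \<in> test_funs U" by (rule test_funs_sum) (rule insert.prems, simp)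
  then have "T (\<lambda>x. 1 * f i x + 1 * (\<Sum>i\<in>I. f i x)) = 1 * T (f i) + 1 * T (\<lambda>x. \<Sum>i\<in>I. f i x)"
    using insert.prems by (intro linear_onD[OF assms(1)]) auto
  then show ?case using insert.IH[OF insert.prems] insert.hyps by simp
qed

text \<open>The integer translates of \<^term>\<open>tent\<close> telescope to a partition of unity.\<close>

definition tent :: testfun where
  "tent t = smooth_step (t + 1) - smooth_step t"

lemma smooth_tent: "smooth_fun tent"
  unfolding tent_def[abs_def]
proof (rule smooth_diff[OF _ smooth_step])
  show "smooth_fun (\<lambda>t. smooth_step (t + 1))" using smooth_affine[OF smooth_step, of 1 1] by simp
qed

lemma tent_eq_0: "\<bar>t\<bar> \<ge> 1 \<Longrightarrow> tent t = 0"
proof (cases "t \<ge> 0")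
  case True
  assume "\<bar>t\<bar> \<ge> 1"
  with True show ?thesis by (simp add: tent_def smooth_step_eq_1)
next
  case False
  assume "\<bar>t\<bar> \<ge> 1"
  with False have "t + 1 \<le> 0" "t \<le> 0" by auto
  then show ?thesis by (simp add: tent_def smooth_step_eq_0)
qed

lemma tent_test_funs: "tent \<in> test_funs UNIV"
proof (rule test_funsI[OF smooth_tent])
  show "t \<in> {-1..1}" if "tent t \<noteq> 0" for t
    using that tent_eq_0[of t] by (cases "\<bar>t\<bar> \<ge> 1") auto
qed auto

lemma sum_tent:
  assumes "N > 0" "\<bar>t\<bar> \<le> real N - 1"
  shows "(\<Sum>j\<in>{-int N..int N}. tent (t - of_int j)) = 1"
proof -
  have "(\<Sum>j\<in>{a..a + int n}. tent (t - of_int j)) = smooth_step (t - of_int a + 1) - smooth_step (t - of_int (a + int n))" for a n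
  proof (induction n)
    case (Suc n)
    have "{a..a + int (Suc n)} = insert (a + int (Suc n)) {a..a + int n}" by auto
    then show ?case using Suc by (simp add: tent_def algebra_simps)
  qed (simp add: tent_def algebra_simps)
  \<comment> \<open>The sum ends at -N + 2N = N. For |t| \<le> N - 1 the first step is already 1 and
    the last one still 0.\<close>
  from this[of "- int N" "2 * N"] show ?thesis
    using assms by (simp add: smooth_step_eq_0 smooth_step_eq_1)
qed

text \<open>The arguments of the two steps are written as affine functions of \<^term>\<open>t\<close> so that smoothness is immediate.\<close>

definition cutoff :: "real \<Rightarrow> real \<Rightarrow> testfun" where
  "cutoff a r t = smooth_step ((2 / r) * t + (2 - 2 * a / r)) * smooth_step ((- 2 / r) * t + (2 + 2 * a / r))"

lemma smooth_cutoff: "smooth_fun (cutoff a r)"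
  unfolding cutoff_def[abs_def]
  by (rule smooth_mult[OF smooth_affine[OF smooth_step] smooth_affine[OF smooth_step]])

lemma cutoff_eq_0:
  assumes "r > 0" "\<bar>t - a\<bar> \<ge> r"
  shows "cutoff a r t = 0"
proof -
  have "(2 / r) * t + (2 - 2 * a / r) = 2 * (t - a + r) / r"
    "(- 2 / r) * t + (2 + 2 * a / r) = 2 * (a + r - t) / r"
    using assms by (simp_all add: field_simps)
  moreover have "t - a + r \<le> 0 \<or> a + r - t \<le> 0" using assms by linarith
  ultimately have "(2 / r) * t + (2 - 2 * a / r) \<le> 0 \<or> (- 2 / r) * t + (2 + 2 * a / r) \<le> 0"
    using assms by (auto simp: divide_le_0_iff)
  then show ?thesis unfolding cutoff_def by (auto simp: smooth_step_eq_0)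
qed

lemma cutoff_eq_1:
  assumes "r > 0" "\<bar>t - a\<bar> \<le> r / 2"
  shows "cutoff a r t = 1"
proof -
  have e: "(2 / r) * t + (2 - 2 * a / r) = 2 * (t - a + r) / r"
    "(- 2 / r) * t + (2 + 2 * a / r) = 2 * (a + r - t) / r"
    using assms by (simp_all add: field_simps)
  have "1 \<le> 2 * (t - a + r) / r" "1 \<le> 2 * (a + r - t) / r"
    using assms unfolding abs_le_iff by (auto simp: le_divide_eq)
  then show ?thesis unfolding cutoff_def e by (simp add: smooth_step_eq_1)
qed

lemma cutoff_test_funs:
  assumes "r > 0" "cball a r \<subseteq> U"
  shows "cutoff a r \<in> test_funs U"
  by (rule test_funsI[OF smooth_cutoff compact_cball assms(2)])
    (use cutoff_eq_0[OF assms(1)] in \<open>force simp: dist_real_def\<close>)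

section \<open>The Fourier transform of test functions\<close>

text \<open>Taken at a product, this is both the Fourier kernel and the modulation e_h, so that
  \<open>kern_add\<close> alone turns modulation into translation.\<close>

definition kern :: "real \<Rightarrow> complex" where
  "kern a = exp (- \<i> * complex_of_real a)"

lemma norm_kern [simp]: "norm (kern a) = 1"
  by (simp add: kern_def norm_exp_eq_Re)

lemma kern_add: "kern (a + b) = kern a * kern b"
  by (simp add: kern_def algebra_simps exp_add[symmetric])

lemma kern_iexp: "kern a = iexp (- a)"
  by (simp add: kern_def)

lemma continuous_on_kern: "continuous_on A kern"
  unfolding kern_def[abs_def] by (intro continuous_intros)

lemma borel_measurable_kern [measurable]: "kern \<in> borel_measurable borel"
  by (rule borel_measurable_continuous_onI[OF continuous_on_kern])

lemma smooth_kern: "smooth_fun (\<lambda>t. kern (h * t))"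
  using smooth_exp_linear[of "- \<i> * complex_of_real h"] by (simp add: kern_def mult_ac)

lemma kern_taylor: "norm (kern a - (1 - \<i> * complex_of_real a)) \<le> a\<^sup>2 / 2"
  using iexp_approx1[of "- a" 1] by (simp add: kern_iexp power2_eq_square numeral_2_eq_2)

lemma fourier_kern: "fourier f t = (LINT x|lborel. kern (t * x) * f x)"
  by (simp add: fourier_def kern_def)

lemma integrable_kern_mult:
  assumes "integrable lborel f"
  shows "integrable lborel (\<lambda>x. kern (t * x) * f x)"
proof (rule Bochner_Integration.integrable_bound[OF assms])
  have [measurable]: "f \<in> borel_measurable borel" using borel_measurable_integrable[OF assms] by simp
  show "(\<lambda>x. kern (t * x) * f x) \<in> borel_measurable lborel" by measurable
qed (simp add: norm_mult)

lemma norm_fourier_le: "norm (fourier f t) \<le> (LINT x|lborel. norm (f x))"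
  unfolding fourier_kern using integral_norm_bound[of lborel "\<lambda>x. kern (t * x) * f x"]
  by (simp add: norm_mult)

lemma borel_measurable_fourier [measurable]:
  assumes [measurable]: "f \<in> borel_measurable borel"
  shows "fourier f \<in> borel_measurable borel"
proof -
  have "(\<lambda>t. LINT x|lborel. kern (t * x) * f x) \<in> borel_measurable borel" by measurable
  then show ?thesis by (simp add: fourier_kern[abs_def])
qed

lemma fourier_add:
  assumes "integrable lborel f" "integrable lborel g"
  shows "fourier (\<lambda>x. f x + g x) t = fourier f t + fourier g t"
  unfolding fourier_kern
  by (simp add: distrib_left integrable_kern_mult assms)

lemma fourier_cmult: "fourier (\<lambda>x. c * f x) t = c * fourier f t"
proof -
  have "(\<lambda>x. kern (t * x) * (c * f x)) = (\<lambda>x. c * (kern (t * x) * f x))" by (auto simp: mult_ac)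
  then show ?thesis unfolding fourier_kern by simp
qed

lemma fourier_kern_mult: "fourier (\<lambda>x. f x * kern (h * x)) t = fourier f (t + h)"
  unfolding fourier_kern distrib_right kern_add by (simp add: mult_ac)

lemma fourier_has_vector_derivative:
  assumes "integrable lborel f" "integrable lborel (\<lambda>x. complex_of_real x * f x)"
    "integrable lborel (\<lambda>x. complex_of_real x ^ 2 * f x)"
  shows "(fourier f has_vector_derivative fourier (\<lambda>x. (- \<i> * complex_of_real x) * f x) t) (at t)"
proof -
  let ?D = "fourier (\<lambda>x. (- \<i> * complex_of_real x) * f x) t"
  let ?M = "LINT x|lborel. norm (complex_of_real x ^ 2 * f x)"
  have D: "integrable lborel (\<lambda>x. (- \<i> * complex_of_real x) * f x)"
    using integrable_mult_right[OF assms(2), of "- \<i>"] by (simp add: mult_ac)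
  \<comment> \<open>The error of the linear approximation is the integral of f against the Taylor
    remainder of the kernel, which is quadratic in h x; this is where the second moment of f
    enters.\<close>
  have bound: "norm (fourier f (t + h) - fourier f t - h *\<^sub>R ?D) \<le> h\<^sup>2 / 2 * ?M" for h
  proof -
    let ?d = "\<lambda>x. kern (t * x) * ((kern (h * x) - (1 - \<i> * complex_of_real (h * x))) * f x)"
    note i = integrable_kern_mult[OF assms(1)] integrable_kern_mult[OF D]
    have "fourier f (t + h) - fourier f t - h *\<^sub>R ?D =
       (LINT x|lborel. kern ((t + h) * x) * f x - kern (t * x) * f x
           - h *\<^sub>R (kern (t * x) * ((- \<i> * complex_of_real x) * f x)))"
      unfolding fourier_kern using i
      by (subst Bochner_Integration.integral_diff Bochner_Integration.integral_diff integral_scaleR_right;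
          (intro Bochner_Integration.integrable_diff integrable_scaleR_right)?; simp)+
    also have "\<dots> = (LINT x|lborel. ?d x)"
      by (rule Bochner_Integration.integral_cong)
        (auto simp: distrib_right kern_add scaleR_conv_of_real algebra_simps)
    also have "norm \<dots> \<le> (LINT x|lborel. norm (?d x))" by (rule integral_norm_bound)
    also have "\<dots> \<le> (LINT x|lborel. h\<^sup>2 / 2 * norm (complex_of_real x ^ 2 * f x))"
    proof (rule integral_mono_AE')
      show "integrable lborel (\<lambda>x. h\<^sup>2 / 2 * norm (complex_of_real x ^ 2 * f x))"
        using assms(3) by simp
      have "norm (?d x) \<le> h\<^sup>2 / 2 * norm (complex_of_real x ^ 2 * f x)" for x
      proof -
        have "norm (?d x) = norm (kern (h * x) - (1 - \<i> * complex_of_real (h * x))) * norm (f x)"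
          by (simp only: norm_mult norm_kern mult_1_left)
        also have "\<dots> \<le> (h * x)\<^sup>2 / 2 * norm (f x)"
          by (intro mult_right_mono kern_taylor) simp
        finally show ?thesis by (simp add: norm_mult norm_power power_mult_distrib)
      qed
      then show "AE x in lborel. norm (?d x) \<le> h\<^sup>2 / 2 * norm (complex_of_real x ^ 2 * f x)" by simp
    qed simp
    finally show ?thesis by simp
  qed
  have "((\<lambda>h. norm (fourier f (t + h) - fourier f t - h *\<^sub>R ?D) / norm h) \<longlongrightarrow> 0) (at 0)"
  proof (rule tendsto_sandwich[of "\<lambda>_. 0" _ _ "\<lambda>h. \<bar>h\<bar> / 2 * ?M"])
    show "\<forall>\<^sub>F h in at 0. norm (fourier f (t + h) - fourier f t - h *\<^sub>R ?D) / norm h \<le> \<bar>h\<bar> / 2 * ?M"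
    proof (rule eventuallyI)
      fix h :: real
      show "norm (fourier f (t + h) - fourier f t - h *\<^sub>R ?D) / norm h \<le> \<bar>h\<bar> / 2 * ?M"
      proof (cases "h = 0")
        case False
        have "norm (fourier f (t + h) - fourier f t - h *\<^sub>R ?D) / \<bar>h\<bar> \<le> (h\<^sup>2 / 2 * ?M) / \<bar>h\<bar>"
          by (rule divide_right_mono[OF bound]) simp
        also have "(h\<^sup>2 / 2 * ?M) / \<bar>h\<bar> = \<bar>h\<bar> / 2 * ?M" using False by (simp add: power2_eq_square abs_if)
        finally show ?thesis by simp
      qed simp
    qed
    show "((\<lambda>h. \<bar>h\<bar> / 2 * ?M) \<longlongrightarrow> 0) (at 0)" by (auto intro!: tendsto_eq_intros)
  qed auto
  then show ?thesis
    unfolding has_vector_derivative_def has_derivative_at by (simp add: bounded_linear_scaleR_left)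
qed

lemma smooth_fourier:
  assumes "\<And>k. integrable lborel (\<lambda>x. complex_of_real x ^ k * f x)"
  shows "smooth_fun (fourier f)"
    and "nderiv k (fourier f) = fourier (\<lambda>x. (- \<i> * complex_of_real x) ^ k * f x)"
proof -
  define D where "D k = fourier (\<lambda>x. (- \<i> * complex_of_real x) ^ k * f x)" for k
  have i: "integrable lborel (\<lambda>x. complex_of_real x ^ j * ((- \<i> * complex_of_real x) ^ k * f x))" for j k
  proof -
    have "complex_of_real x ^ j * ((- \<i> * complex_of_real x) ^ k * f x) = (- \<i>) ^ k * (complex_of_real x ^ (j + k) * f x)" for x
      by (simp only: power_mult_distrib power_add mult_ac)
    then show ?thesis using integrable_mult_right[OF assms[of "j + k"], of "(- \<i>) ^ k"] by presburger
  qed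
  have "(D k has_vector_derivative D (Suc k) t) (at t)" for k t
    using fourier_has_vector_derivative[of "\<lambda>x. (- \<i> * complex_of_real x) ^ k * f x" t]
      i[of 0 k] i[of 1 k] i[of 2 k] by (simp add: D_def mult_ac)
  moreover have "D 0 = fourier f" by (simp add: D_def)
  ultimately show "smooth_fun (fourier f)" "nderiv k (fourier f) = fourier (\<lambda>x. (- \<i> * complex_of_real x) ^ k * f x)"
    using smooth_funI_sequence[of D "fourier f"] by (auto simp: D_def)
qed

lemma integral_nderiv_test_funs:
  assumes "f \<in> test_funs U"
  shows "(LINT x|lborel. nderiv 1 f x) = 0"
proof -
  obtain R where R: "R > 0" "\<And>x. \<bar>x\<bar> > R \<Longrightarrow> f x = 0" using test_funs_interval[OF assms] by metis
  obtain R' where R': "R' > 0" "\<And>x. \<bar>x\<bar> > R' \<Longrightarrow> nderiv 1 f x = 0"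
    using test_funs_interval[OF test_funs_nderiv[OF assms]] by metis
  \<comment> \<open>The \<open>+ 1\<close> puts both endpoints strictly beyond the radii, where f
    and its derivative are known to vanish.\<close>
  define a where "a = max R R' + 1"
  have "(LINT x|lborel. indicator {-a..a} x *\<^sub>R nderiv 1 f x) = f a - f (- a)"
  proof (rule integral_FTC_Icc)
    show "- a \<le> a" using R by (simp add: a_def)
    show "(f has_vector_derivative nderiv 1 f x) (at x within {-a..a})" for x
      using nderiv_has_vector_derivative[OF test_funsD(1)[OF assms], of 0 x]
      by (simp add: has_vector_derivative_at_within)
    show "continuous_on {-a..a} (nderiv 1 f)"
      by (rule smooth_continuous_nderiv[OF test_funsD(1)[OF assms]])
  qed
  moreover have "(\<lambda>x. indicator {-a..a} x *\<^sub>R nderiv 1 f x) = nderiv 1 f"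
    using R' by (force simp: indicator_def a_def)
  ultimately show ?thesis using R by (simp add: a_def)
qed

text \<open>Integration by parts without boundary terms: the derivative of
  \<open>kern (x * t) * f t\<close> is that of a test function, so its integral is zero.\<close>

lemma fourier_nderiv:
  assumes "f \<in> test_funs U"
  shows "fourier (nderiv m f) x = (\<i> * complex_of_real x) ^ m * fourier f x"
  using assms
proof (induction m arbitrary: f)
  case (Suc m)
  note t = test_funs_nderiv[OF Suc.prems]
  have g: "(\<lambda>t. kern (x * t) * f t) \<in> test_funs U" by (rule test_funs_mult(2)[OF Suc.prems smooth_kern])
  have "((\<lambda>t. kern (x * t)) has_vector_derivative - \<i> * complex_of_real x * kern (x * t)) (at t)" for t
  proof -
    have "((\<lambda>z. exp (- \<i> * complex_of_real x * z)) has_field_derivative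
        - \<i> * complex_of_real x * exp (- \<i> * complex_of_real x * complex_of_real t)) (at (complex_of_real t))"
      by (auto intro!: derivative_eq_intros)
    from has_vector_derivative_real_field[OF this] show ?thesis
      by (simp add: kern_def mult.assoc)
  qed
  moreover have "(f has_vector_derivative nderiv 1 f t) (at t)" for t
    using nderiv_has_vector_derivative[OF test_funsD(1)[OF Suc.prems], of 0 t] by simp
  ultimately have "((\<lambda>t. kern (x * t) * f t) has_vector_derivative
      kern (x * t) * nderiv 1 f t + - \<i> * complex_of_real x * kern (x * t) * f t) (at t)" for t
    by (rule has_vector_derivative_mult)
  then have "nderiv 1 (\<lambda>t. kern (x * t) * f t) =
      (\<lambda>t. kern (x * t) * nderiv 1 f t + - \<i> * complex_of_real x * (kern (x * t) * f t))"
    by (auto simp: vector_derivative_at mult.assoc)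
  then have "(LINT t|lborel. kern (x * t) * nderiv 1 f t + - \<i> * complex_of_real x * (kern (x * t) * f t)) = 0"
    using integral_nderiv_test_funs[OF g] by simp
  moreover have "(LINT t|lborel. kern (x * t) * nderiv 1 f t + - \<i> * complex_of_real x * (kern (x * t) * f t))
     = fourier (nderiv 1 f) x + - \<i> * complex_of_real x * fourier f x"
    unfolding fourier_kern
    using integrable_kern_mult[OF test_funs_integrable[OF Suc.prems]] integrable_kern_mult[OF test_funs_integrable[OF t]]
    by (subst Bochner_Integration.integral_add) (auto simp del: nderiv.simps)
  ultimately have "fourier (nderiv 1 f) x = \<i> * complex_of_real x * fourier f x"
    by (simp add: add_eq_0_iff)
  then show ?case
    using Suc.IH[OF t[of 1]] nderiv_Suc_shift[of m f] by (simp only: power_Suc mult_ac)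
qed simp

section \<open>Decay and the Schwartz class\<close>

lemma integrable_cauchy_density: "integrable lborel (\<lambda>x::real. inverse (1 + x\<^sup>2))"
  using integrable_inverse_1_plus_square by (simp add: set_integrable_def einterval_eq_UNIV)

lemma integrable_decay:
  fixes f :: testfun
  assumes "f \<in> borel_measurable borel" "\<And>x. norm (f x) * (1 + x\<^sup>2) \<le> C"
  shows "integrable lborel f"
proof (rule Bochner_Integration.integrable_bound)
  show "integrable lborel (\<lambda>x::real. C * inverse (1 + x\<^sup>2))"
    using integrable_cauchy_density by simp
  have "norm (f x) \<le> norm (C * inverse (1 + x\<^sup>2))" for x
  proof -
    have p: "0 < 1 + x\<^sup>2" by (simp add: add_pos_nonneg)
    have "norm (f x) \<le> C / (1 + x\<^sup>2)" using assms(2)[of x] p by (simp add: pos_le_divide_eq)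
    then show ?thesis by (simp add: divide_inverse)
  qed
  then show "AE x in lborel. norm (f x) \<le> norm (C * inverse (1 + x\<^sup>2))" by simp
qed (use assms in simp)

lemma schwartz_integrable:
  assumes "f \<in> schwartz"
  shows "integrable lborel (\<lambda>x. complex_of_real x ^ k * f x)"
proof -
  have s: "smooth_fun f" and b': "\<And>m k. bounded (range (\<lambda>x. complex_of_real x ^ m * nderiv k f x))"
    using assms unfolding schwartz_def by blast+
  have b: "\<And>m. bounded (range (\<lambda>x. complex_of_real x ^ m * f x))" using b'[of _ 0] by simp
  obtain A where A: "\<And>x. norm (complex_of_real x ^ k * f x) \<le> A"
    using b[of k] unfolding bounded_iff by auto
  obtain B where B: "\<And>x. norm (complex_of_real x ^ (k + 2) * f x) \<le> B"
    using b[of "k + 2"] unfolding bounded_iff by auto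
  have "norm (complex_of_real x ^ k * f x) * (1 + x\<^sup>2) \<le> A + B" for x
    using A[of x] B[of x] by (simp add: norm_mult norm_power power_add algebra_simps power2_eq_square)
  moreover have "continuous_on UNIV (\<lambda>x. complex_of_real x ^ k * f x)"
    by (intro continuous_intros smooth_continuous[OF s])
  ultimately show ?thesis
    by (intro integrable_decay[of _ "A + B"] borel_measurable_continuous_onI) auto
qed

lemma smooth_fourier_schwartz: "f \<in> schwartz \<Longrightarrow> smooth_fun (fourier f)"
  by (rule smooth_fourier(1)) (rule schwartz_integrable)

text \<open>Differentiation and multiplication by x trade places under the transform, so each
  seminorm is the sup norm of the transform of another test function, which its L^1 norm
  bounds.\<close>

lemma fourier_test_funs_schwartz:
  assumes "f \<in> test_funs U"
  shows "fourier f \<in> schwartz"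
proof -
  note i = schwartz_integrable[OF test_funs_schwartz[OF assms]]
  have "bounded (range (\<lambda>x. complex_of_real x ^ m * nderiv k (fourier f) x))" for m k
  proof -
    define g where "g = (\<lambda>x. (- \<i> * complex_of_real x) ^ k * f x)"
    have "smooth_fun (\<lambda>x. (- \<i>) ^ k * complex_of_real x ^ k)"
      by (rule smooth_mult[OF smooth_const smooth_of_real_power])
    then have g: "g \<in> test_funs U"
      unfolding g_def power_mult_distrib by (rule test_funs_mult(2)[OF assms])
    have "nderiv k (fourier f) = fourier g" by (simp only: smooth_fourier(2)[OF i] g_def)
    then have "norm (complex_of_real x ^ m * nderiv k (fourier f) x) = norm (fourier (nderiv m g) x)" for x
      using fourier_nderiv[OF g, of m x] by (simp add: norm_mult norm_power)
    then have "norm (complex_of_real x ^ m * nderiv k (fourier f) x) \<le> (LINT x|lborel. norm (nderiv m g x))" for x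
      using norm_fourier_le[of "nderiv m g" x] by simp
    then show ?thesis unfolding bounded_iff by blast
  qed
  then show ?thesis using smooth_fourier(1)[OF i] by (simp add: schwartz_def)
qed

section \<open>Fourier inversion\<close>

lemma gaussian_integrable: "integrable lborel std_normal_density"
  by (rule integrable_normal_density) simp

text \<open>The left side is the characteristic function of the standard normal law, exp(-t^2/2);
  the factor sqrt(2 pi) only undoes the normalisation of the density.\<close>

lemma fourier_gaussian:
  "(LINT x|lborel. kern (t * x) * complex_of_real (std_normal_density x)) = complex_of_real (sqrt (2 * pi) * std_normal_density t)"
proof -
  have "(LINT x|lborel. kern (t * x) * complex_of_real (std_normal_density x))
      = (LINT x|lborel. std_normal_density x *\<^sub>R iexp (- t * x))"
    by (simp add: kern_iexp scaleR_conv_of_real mult.commute)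
  also have "\<dots> = (LINT x|std_normal_distribution. iexp (- t * x))"
    by (subst integral_density) (auto simp: normal_density_nonneg)
  also have "\<dots> = complex_of_real (exp (- ((- t)\<^sup>2) / 2))"
    using char_std_normal_distribution unfolding char_def by metis
  also have "\<dots> = complex_of_real (sqrt (2 * pi) * std_normal_density t)"
    by (simp add: std_normal_density_def)
  finally show ?thesis .
qed

lemma fourier_gaussian_scaled:
  assumes "e > 0"
  shows "(LINT x|lborel. kern (t * x) * complex_of_real (std_normal_density (e * x)))
    = complex_of_real (sqrt (2 * pi) / e * std_normal_density (t / e))"
proof -
  have "(LINT x|lborel. kern (t / e * x) * complex_of_real (std_normal_density x))
      = \<bar>e\<bar> *\<^sub>R (LINT x|lborel. kern (t / e * (0 + e * x)) * complex_of_real (std_normal_density (0 + e * x)))"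
    by (rule lborel_integral_real_affine) (use assms in simp)
  moreover have "t / e * (0 + e * x) = t * x" for x using assms by simp
  ultimately have "e *\<^sub>R (LINT x|lborel. kern (t * x) * complex_of_real (std_normal_density (e * x)))
      = complex_of_real (sqrt (2 * pi) * std_normal_density (t / e))"
    using assms unfolding fourier_gaussian by simp
  then show ?thesis using assms by (simp add: scaleR_conv_of_real field_simps)
qed

lemma integrable_pair_mult:
  fixes f g :: testfun
  assumes f: "integrable lborel f" and g: "integrable lborel g"
  shows "integrable (lborel \<Otimes>\<^sub>M lborel) (\<lambda>(x, y). f x * g y)"
proof -
  have [measurable]: "f \<in> borel_measurable borel" "g \<in> borel_measurable borel"
    using f g borel_measurable_integrable by force+
  show ?thesis
  proof (rule lborel_pair.Fubini_integrable)
    show "(\<lambda>(x, y). f x * g y) \<in> borel_measurable (lborel \<Otimes>\<^sub>M lborel)" by measurable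
    show "integrable lborel (\<lambda>x. LINT y|lborel. norm (case (x, y) of (x, y) \<Rightarrow> f x * g y))"
      using f by (simp add: norm_mult integrable_norm)
    show "AE x in lborel. integrable lborel (\<lambda>y. case (x, y) of (x, y) \<Rightarrow> f x * g y)"
      using g by simp
  qed
qed

text \<open>A bounded kernel does not disturb the absolute integrability of f x * g y; the kernels
  meant are products of characters.\<close>

lemma Fubini_kernel:
  fixes f g :: testfun and K :: "real \<Rightarrow> real \<Rightarrow> complex"
  assumes f: "integrable lborel f" and g: "integrable lborel g"
    and K: "(\<lambda>(x, y). K x y) \<in> borel_measurable (borel \<Otimes>\<^sub>M borel)" "\<And>x y. norm (K x y) \<le> C"
  shows "integrable (lborel \<Otimes>\<^sub>M lborel) (\<lambda>(x, y). K x y * (f x * g y))"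
    and "(LINT y|lborel. LINT x|lborel. K x y * (f x * g y)) = (LINT x|lborel. LINT y|lborel. K x y * (f x * g y))"
proof -
  have [measurable]: "f \<in> borel_measurable borel" "g \<in> borel_measurable borel"
    using f g borel_measurable_integrable by force+
  note [measurable] = K(1)
  show i: "integrable (lborel \<Otimes>\<^sub>M lborel) (\<lambda>(x, y). K x y * (f x * g y))"
  proof (rule Bochner_Integration.integrable_bound)
    show "integrable (lborel \<Otimes>\<^sub>M lborel) (\<lambda>z. complex_of_real C * (case z of (x, y) \<Rightarrow> f x * g y))"
      by (rule integrable_mult_right[OF integrable_pair_mult[OF f g]])
    have "norm (K x y * (f x * g y)) \<le> norm (complex_of_real C * (f x * g y))" for x y
      using mult_right_mono[OF order_trans[OF K(2)[of x y] abs_ge_self], of "norm (f x * g y)"]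
      by (simp add: norm_mult)
    then show "AE z in lborel \<Otimes>\<^sub>M lborel. norm (case z of (x, y) \<Rightarrow> K x y * (f x * g y))
        \<le> norm (complex_of_real C * (case z of (x, y) \<Rightarrow> f x * g y))"
      by (auto split: prod.split)
  qed measurable
  show "(LINT y|lborel. LINT x|lborel. K x y * (f x * g y)) = (LINT x|lborel. LINT y|lborel. K x y * (f x * g y))"
    by (rule lborel_pair.Fubini_integral) (use i in simp)
qed

text \<open>The Gaussian damping makes the double integral absolutely convergent. After the exchange
  the inner integral is again a Gaussian, of width e and centred at -t, so the right side is a mean
  of f near -t.\<close>

lemma fourier_fourier_mollified:
  assumes "f \<in> test_funs U" "e > 0"
  shows "(LINT x|lborel. complex_of_real (std_normal_density (e * x)) * (kern (t * x) * fourier f x))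
    = sqrt (2 * pi) *\<^sub>R (LINT s|lborel. std_normal_density s *\<^sub>R f (- t + e * s))"
proof -
  note f = test_funs_integrable[OF assms(1)]
  note [measurable] = test_funs_measurable[OF assms(1)]
  have g: "integrable lborel (\<lambda>x. complex_of_real (std_normal_density (e * x)))"
    using lborel_integrable_real_affine[OF gaussian_integrable, of e 0] assms(2) by simp
  have "(LINT x|lborel. complex_of_real (std_normal_density (e * x)) * (kern (t * x) * fourier f x))
      = (LINT x|lborel. LINT y|lborel. (kern (t * x) * kern (x * y)) * (f y * complex_of_real (std_normal_density (e * x))))"
  proof (rule Bochner_Integration.integral_cong[OF refl])
    fix x
    have "(LINT y|lborel. (kern (t * x) * kern (x * y)) * (f y * complex_of_real (std_normal_density (e * x))))
       = (LINT y|lborel. (complex_of_real (std_normal_density (e * x)) * kern (t * x)) * (kern (x * y) * f y))"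
      by (rule Bochner_Integration.integral_cong) (auto simp: mult_ac)
    then show "complex_of_real (std_normal_density (e * x)) * (kern (t * x) * fourier f x) =
      (LINT y|lborel. (kern (t * x) * kern (x * y)) * (f y * complex_of_real (std_normal_density (e * x))))"
      by (simp only: fourier_kern mult.assoc integral_mult_right_zero)
  qed
  also have "\<dots> = (LINT y|lborel. LINT x|lborel. (kern (t * x) * kern (x * y)) * (f y * complex_of_real (std_normal_density (e * x))))"
    by (rule Fubini_kernel(2)[OF f g, where C=1]) (auto simp: norm_mult)
  also have "\<dots> = (LINT y|lborel. f y * complex_of_real (sqrt (2 * pi) / e * std_normal_density ((t + y) / e)))"
  proof (rule Bochner_Integration.integral_cong[OF refl])
    fix y
    have "(LINT x|lborel. (kern (t * x) * kern (x * y)) * (f y * complex_of_real (std_normal_density (e * x))))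
      = (LINT x|lborel. f y * (kern ((t + y) * x) * complex_of_real (std_normal_density (e * x))))"
      unfolding distrib_right kern_add by (rule Bochner_Integration.integral_cong) (auto simp: mult_ac)
    then show "(LINT x|lborel. (kern (t * x) * kern (x * y)) * (f y * complex_of_real (std_normal_density (e * x))))
      = f y * complex_of_real (sqrt (2 * pi) / e * std_normal_density ((t + y) / e))"
      by (simp only: fourier_gaussian_scaled[OF assms(2)] integral_mult_right_zero)
  qed
  also have "\<dots> = \<bar>e\<bar> *\<^sub>R (LINT s|lborel. f (- t + e * s) * complex_of_real (sqrt (2 * pi) / e * std_normal_density ((t + (- t + e * s)) / e)))"
    by (rule lborel_integral_real_affine) (use assms in simp)
  also have "\<dots> = \<bar>e\<bar> *\<^sub>R (LINT s|lborel. (sqrt (2 * pi) / e) *\<^sub>R (std_normal_density s *\<^sub>R f (- t + e * s)))"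
    using assms(2) by (simp add: scaleR_conv_of_real mult_ac)
  also have "\<dots> = sqrt (2 * pi) *\<^sub>R (LINT s|lborel. std_normal_density s *\<^sub>R f (- t + e * s))"
    using assms(2) by (subst integral_scaleR_right) simp
  finally show ?thesis .
qed

text \<open>Let e tend to 0 on both sides of the mollified identity. Dominated convergence applies
  on the left because the density is at most 1/sqrt(2 pi) and \<open>fourier f\<close> is
  integrable, on the right because f is bounded and continuous.\<close>

theorem fourier_inversion:
  fixes f :: testfun
  assumes f: "f \<in> test_funs U"
  shows "fourier (fourier f) t = 2 * pi * f (- t)"
proof -
  define e where "e n = inverse (real (Suc n))" for n
  have e: "e n > 0" "e \<longlonglongrightarrow> 0" for n
    unfolding e_def using LIMSEQ_inverse_real_of_nat by simp_all
  note [measurable] = test_funs_measurable[OF f]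
  obtain B where B: "\<And>x. norm (f x) \<le> B" using test_funs_bounded[OF f] by metis
  have ff: "integrable lborel (fourier f)"
    using schwartz_integrable[OF fourier_test_funs_schwartz[OF f], of 0] by simp
  have cont: "isCont f x" for x
    using test_funs_continuous[OF f, of UNIV] by (simp add: continuous_on_eq_continuous_at)
  have n0: "std_normal_density 0 = 1 / sqrt (2 * pi)" by (simp add: std_normal_density_def)
  have nle: "std_normal_density x \<le> 1 / sqrt (2 * pi)" for x
    by (simp add: std_normal_density_def divide_right_mono)
  have nc: "isCont std_normal_density x" for x
    unfolding std_normal_density_def by (intro continuous_intros) auto
  let ?I = "\<lambda>n. LINT x|lborel. complex_of_real (std_normal_density (e n * x)) * (kern (t * x) * fourier f x)"
  have "?I \<longlonglongrightarrow> (LINT x|lborel. complex_of_real (std_normal_density 0) * (kern (t * x) * fourier f x))"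
  proof (rule integral_dominated_convergence)
    show "integrable lborel (\<lambda>x. 1 / sqrt (2 * pi) * norm (fourier f x))" using ff by simp
    show "AE x in lborel. (\<lambda>n. complex_of_real (std_normal_density (e n * x)) * (kern (t * x) * fourier f x))
       \<longlonglongrightarrow> complex_of_real (std_normal_density 0) * (kern (t * x) * fourier f x)"
    proof (rule AE_I2)
      fix x
      have "(\<lambda>n. e n * x) \<longlonglongrightarrow> 0" using tendsto_mult_right[OF e(2), of x] by simp
      from isCont_tendsto_compose[OF nc this]
      show "(\<lambda>n. complex_of_real (std_normal_density (e n * x)) * (kern (t * x) * fourier f x))
       \<longlonglongrightarrow> complex_of_real (std_normal_density 0) * (kern (t * x) * fourier f x)"
        by (intro tendsto_mult tendsto_of_real tendsto_const)
    qed
    show "AE x in lborel. norm (complex_of_real (std_normal_density (e n * x)) * (kern (t * x) * fourier f x))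
      \<le> 1 / sqrt (2 * pi) * norm (fourier f x)" for n
      using nle by (auto simp: norm_mult normal_density_nonneg simp del: times_divide_eq_left intro!: mult_right_mono)
  qed measurable
  then have 1: "?I \<longlonglongrightarrow> complex_of_real (1 / sqrt (2 * pi)) * fourier (fourier f) t"
    by (simp only: n0 fourier_kern[of "fourier f"] integral_mult_right_zero)
  have "(\<lambda>n. LINT s|lborel. std_normal_density s *\<^sub>R f (- t + e n * s)) \<longlonglongrightarrow> (LINT s|lborel. std_normal_density s *\<^sub>R f (- t))"
  proof (rule integral_dominated_convergence)
    show "integrable lborel (\<lambda>s. B * std_normal_density s)" using gaussian_integrable by simp
    show "AE s in lborel. (\<lambda>n. std_normal_density s *\<^sub>R f (- t + e n * s)) \<longlonglongrightarrow> std_normal_density s *\<^sub>R f (- t)"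
    proof (rule AE_I2)
      fix s
      have "(\<lambda>n. - t + e n * s) \<longlonglongrightarrow> - t" by (rule tendsto_eq_intros e(2) refl | simp)+
      from isCont_tendsto_compose[OF cont this]
      show "(\<lambda>n. std_normal_density s *\<^sub>R f (- t + e n * s)) \<longlonglongrightarrow> std_normal_density s *\<^sub>R f (- t)"
        by (rule tendsto_scaleR[OF tendsto_const])
    qed
    show "AE s in lborel. norm (std_normal_density s *\<^sub>R f (- t + e n * s)) \<le> B * std_normal_density s" for n
    proof (rule AE_I2)
      fix s
      show "norm (std_normal_density s *\<^sub>R f (- t + e n * s)) \<le> B * std_normal_density s"
        using mult_right_mono[OF B[of "- t + e n * s"] normal_density_nonneg[of 0 1 s]]
        by (simp add: normal_density_nonneg mult.commute)
    qed
  qed measurable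
  moreover have "(LINT s|lborel. std_normal_density s *\<^sub>R f (- t)) = f (- t)"
    using integral_normal_density[of 1 0] gaussian_integrable by simp
  ultimately have "(\<lambda>n. sqrt (2 * pi) *\<^sub>R (LINT s|lborel. std_normal_density s *\<^sub>R f (- t + e n * s))) \<longlonglongrightarrow> sqrt (2 * pi) *\<^sub>R f (- t)"
    by (intro tendsto_scaleR tendsto_const) simp
  then have "?I \<longlonglongrightarrow> sqrt (2 * pi) *\<^sub>R f (- t)"
    using fourier_fourier_mollified[OF f e(1)] by simp
  from LIMSEQ_unique[OF 1 this] have "complex_of_real (1 / sqrt (2 * pi)) * fourier (fourier f) t = complex_of_real (sqrt (2 * pi)) * f (- t)"
    by (simp add: scaleR_conv_of_real)
  then have "complex_of_real (sqrt (2 * pi) * (1 / sqrt (2 * pi))) * fourier (fourier f) t = complex_of_real (sqrt (2 * pi) * sqrt (2 * pi)) * f (- t)"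
    by (simp only: of_real_mult mult.assoc)
  moreover have "sqrt (2 * pi) * (1 / sqrt (2 * pi)) = 1" "sqrt (2 * pi) * sqrt (2 * pi) = 2 * pi" by simp_all
  ultimately show ?thesis by (simp only: of_real_1 mult_1_left)
qed

section \<open>The Wiener norm and pseudomeasures\<close>

text \<open>The norm of the Fourier algebra without its factor 1/(2 pi), which therefore shows up in
  \<open>wnorm_mult_le\<close> and in the bound for pseudomeasures.\<close>

definition wnorm :: "testfun \<Rightarrow> real" where
  "wnorm f = (LINT x|lborel. norm (fourier f x))"

lemma integrable_fourier_test_funs:
  assumes "f \<in> test_funs U"
  shows "integrable lborel (fourier f)"
  using schwartz_integrable[OF fourier_test_funs_schwartz[OF assms], of 0] by simp

lemma wnorm_nonneg: "wnorm f \<ge> 0"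
  by (simp add: wnorm_def)

lemma wnorm_cmult: "wnorm (\<lambda>x. c * f x) = norm c * wnorm f"
  by (simp add: wnorm_def fourier_cmult norm_mult)

lemma wnorm_add_le:
  assumes "f \<in> test_funs U" "g \<in> test_funs V"
  shows "wnorm (\<lambda>x. f x + g x) \<le> wnorm f + wnorm g"
proof -
  note i = integrable_fourier_test_funs[OF assms(1)] integrable_fourier_test_funs[OF assms(2)]
  have "fourier (\<lambda>x. f x + g x) t = fourier f t + fourier g t" for t
    using assms by (intro fourier_add test_funs_integrable)
  then have "wnorm (\<lambda>x. f x + g x) = (LINT x|lborel. norm (fourier f x + fourier g x))"
    by (simp add: wnorm_def)
  also have "\<dots> \<le> (LINT x|lborel. norm (fourier f x) + norm (fourier g x))"
    using i by (intro integral_mono) (auto intro: norm_triangle_ineq)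
  also have "\<dots> = wnorm f + wnorm g"
    using i by (simp add: wnorm_def)
  finally show ?thesis .
qed

text \<open>Modulation translates the Fourier transform, which preserves its L^1 norm. This is the
  source of every estimate that is uniform in h.\<close>

lemma wnorm_kern_mult: "wnorm (\<lambda>x. f x * kern (h * x)) = wnorm f"
  using lborel_integral_real_affine[of 1 "\<lambda>x. norm (fourier f x)" h]
  by (simp add: wnorm_def fourier_kern_mult add.commute)

text \<open>Invariance under dilation is what makes \<^term>\<open>wnorm (\<lambda>t. complex_of_real (t - t0) * \<psi> t)\<close> of order \<^term>\<open>d\<close> for a bump \<^term>\<open>\<psi>\<close> of width \<^term>\<open>d\<close> near \<^term>\<open>t0\<close>.\<close>

lemma wnorm_affine:
  assumes "a \<noteq> 0"
  shows "wnorm (\<lambda>t. f (a * t + b)) = wnorm f"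
proof -
  have *: "norm (fourier (\<lambda>t. f (a * t + b)) x) = norm (fourier f (0 + inverse a * x)) / \<bar>a\<bar>" for x
  proof -
    have "fourier f (x / a) = \<bar>a\<bar> *\<^sub>R (LINT t|lborel. kern (x / a * (b + a * t)) * f (b + a * t))"
      unfolding fourier_kern by (rule lborel_integral_real_affine[OF assms])
    also have "(LINT t|lborel. kern (x / a * (b + a * t)) * f (b + a * t))
      = (LINT t|lborel. kern (x / a * b) * (kern (x * t) * f (a * t + b)))"
      using assms by (intro Bochner_Integration.integral_cong) (auto simp: distrib_left kern_add mult.assoc add.commute)
    also have "\<dots> = kern (x / a * b) * fourier (\<lambda>t. f (a * t + b)) x"
      by (simp only: fourier_kern integral_mult_right_zero)
    finally have "norm (fourier f (x / a)) = \<bar>a\<bar> * norm (fourier (\<lambda>t. f (a * t + b)) x)"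
      by (simp add: norm_mult del: times_divide_eq_left)
    then show ?thesis using assms by (simp add: divide_inverse mult_ac)
  qed
  have "wnorm f = \<bar>inverse a\<bar> *\<^sub>R (LINT x|lborel. norm (fourier f (0 + inverse a * x)))"
    unfolding wnorm_def by (rule lborel_integral_real_affine) (use assms in simp)
  then show ?thesis unfolding wnorm_def * by (simp add: divide_inverse mult.commute)
qed

text \<open>Integrating in x first leaves the L^1 norm of g, which reflection and translation do not
  change. The bounded weight K makes room for the Fourier transform of a pseudomeasure.\<close>

lemma integrable_convolution_kernel:
  fixes f g K :: testfun
  assumes f: "integrable lborel f" and g: "integrable lborel g"
    and K: "K \<in> borel_measurable borel" "\<And>x. norm (K x) \<le> C"
  shows "integrable (lborel \<Otimes>\<^sub>M lborel) (\<lambda>(h, x). K x * (f h * g (h - x)))"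
proof -
  have [measurable]: "f \<in> borel_measurable borel" "g \<in> borel_measurable borel" "K \<in> borel_measurable borel"
    using f g K borel_measurable_integrable by force+
  have g': "integrable lborel (\<lambda>x. g (h - x))" for h
    using lborel_integrable_real_affine[OF g, of "-1" h] by simp
  have eq: "(LINT x|lborel. norm (g (h - x))) = (LINT x|lborel. norm (g x))" for h
    using lborel_integral_real_affine[of "-1" "\<lambda>x. norm (g x)" h] by simp
  have 1: "integrable (lborel \<Otimes>\<^sub>M lborel) (\<lambda>(h, x). f h * g (h - x))"
  proof (rule lborel_pair.Fubini_integrable)
    show "(\<lambda>(h, x). f h * g (h - x)) \<in> borel_measurable (lborel \<Otimes>\<^sub>M lborel)" by measurable
    show "integrable lborel (\<lambda>h. LINT x|lborel. norm (case (h, x) of (h, x) \<Rightarrow> f h * g (h - x)))"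
      using f by (simp add: norm_mult eq)
    show "AE h in lborel. integrable lborel (\<lambda>x. case (h, x) of (h, x) \<Rightarrow> f h * g (h - x))"
      using g' by simp
  qed
  show ?thesis
  proof (rule Bochner_Integration.integrable_bound)
    show "integrable (lborel \<Otimes>\<^sub>M lborel) (\<lambda>z. complex_of_real C * (case z of (h, x) \<Rightarrow> f h * g (h - x)))"
      by (rule integrable_mult_right[OF 1])
    have "norm (K x * (f h * g (h - x))) \<le> norm (complex_of_real C * (f h * g (h - x)))" for h x
      using mult_right_mono[OF order_trans[OF K(2)[of x] abs_ge_self], of "norm (f h * g (h - x))"]
      by (simp add: norm_mult)
    then show "AE z in lborel \<Otimes>\<^sub>M lborel. norm (case z of (h, x) \<Rightarrow> K x * (f h * g (h - x)))
        \<le> norm (complex_of_real C * (case z of (h, x) \<Rightarrow> f h * g (h - x)))"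
      by (auto split: prod.split)
  qed measurable
qed

text \<open>With one factor given as a Fourier transform, the convolution formula is a mere exchange
  of integrals. The argument \<open>- x\<close> fits the reflection in
  \<open>inv_fourier\<close>.\<close>

lemma fourier_mult_fourier:
  assumes th: "integrable lborel \<theta>" and ph: "integrable lborel \<phi>"
  shows "fourier (\<lambda>t. \<theta> t * fourier \<phi> t) (- x) = (LINT h|lborel. \<phi> h * fourier \<theta> (h - x))"
proof -
  have [measurable]: "\<theta> \<in> borel_measurable borel" "\<phi> \<in> borel_measurable borel"
    using th ph borel_measurable_integrable by force+
  have "fourier (\<lambda>t. \<theta> t * fourier \<phi> t) (- x)
    = (LINT t|lborel. LINT h|lborel. (kern (- x * t) * kern (t * h)) * (\<theta> t * \<phi> h))"
  proof -
    have "kern (- x * t) * (\<theta> t * fourier \<phi> t) = (LINT h|lborel. (kern (- x * t) * kern (t * h)) * (\<theta> t * \<phi> h))" for t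
    proof -
      have "kern (- x * t) * (\<theta> t * fourier \<phi> t) = (LINT h|lborel. (kern (- x * t) * \<theta> t) * (kern (t * h) * \<phi> h))"
        by (simp only: fourier_kern integral_mult_right_zero mult.assoc)
      then show ?thesis by (simp only: mult_ac)
    qed
    then show ?thesis by (simp only: fourier_kern[of "\<lambda>t. \<theta> t * fourier \<phi> t"])
  qed
  also have "\<dots> = (LINT h|lborel. LINT t|lborel. (kern (- x * t) * kern (t * h)) * (\<theta> t * \<phi> h))"
    by (rule Fubini_kernel(2)[OF th ph, where C=1, symmetric]) (auto simp: norm_mult)
  also have "\<dots> = (LINT h|lborel. \<phi> h * fourier \<theta> (h - x))"
  proof (rule Bochner_Integration.integral_cong[OF refl])
    fix h
    have e: "kern ((h - x) * t) = kern (- x * t) * kern (t * h)" for t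
      using kern_add[of "- x * t" "t * h"] by (simp add: algebra_simps)
    have "(LINT t|lborel. (kern (- x * t) * kern (t * h)) * (\<theta> t * \<phi> h)) = (LINT t|lborel. \<phi> h * (kern ((h - x) * t) * \<theta> t))"
      unfolding e by (rule Bochner_Integration.integral_cong) (simp_all add: mult_ac)
    then show "(LINT t|lborel. (kern (- x * t) * kern (t * h)) * (\<theta> t * \<phi> h)) = \<phi> h * fourier \<theta> (h - x)"
      by (simp only: fourier_kern integral_mult_right_zero)
  qed
  finally show ?thesis .
qed

definition inv_fourier :: "testfun \<Rightarrow> testfun" where
  "inv_fourier f x = fourier f (- x) / (2 * pi)"

text \<open>As the transform of a reflected test function, the inverse transform inherits the
  Schwartz property and the inversion formula.\<close>

lemma inv_fourier_altdef: "inv_fourier f = fourier (\<lambda>t. inverse (complex_of_real (2 * pi)) * f (- t))"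
proof
  fix x
  have "fourier f (- x) = \<bar>-1\<bar> *\<^sub>R (LINT t|lborel. kern (- x * (0 + -1 * t)) * f (0 + -1 * t))"
    unfolding fourier_kern by (rule lborel_integral_real_affine) simp
  then have "fourier f (- x) = fourier (\<lambda>t. f (- t)) x"
    unfolding fourier_kern by simp
  then show "inv_fourier f x = fourier (\<lambda>t. inverse (complex_of_real (2 * pi)) * f (- t)) x"
    by (simp only: inv_fourier_def fourier_cmult divide_inverse) (rule mult.commute)
qed

lemma test_funs_reflect:
  "f \<in> test_funs UNIV \<Longrightarrow> (\<lambda>t. inverse (complex_of_real (2 * pi)) * f (- t)) \<in> test_funs UNIV"
  by (rule test_funs_cmult[OF test_funs_uminus_arg])

lemma inv_fourier_schwartz: "f \<in> test_funs UNIV \<Longrightarrow> inv_fourier f \<in> schwartz"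
  unfolding inv_fourier_altdef by (rule fourier_test_funs_schwartz[OF test_funs_reflect])

lemma fourier_inv_fourier:
  assumes "f \<in> test_funs UNIV"
  shows "fourier (inv_fourier f) = f"
  using fourier_inversion[OF test_funs_reflect[OF assms]] unfolding inv_fourier_altdef by auto

lemma integral_norm_inv_fourier: "(LINT x|lborel. norm (inv_fourier f x)) = wnorm f / (2 * pi)"
  using lborel_integral_real_affine[of "-1" "\<lambda>x. norm (fourier f x)" 0]
  by (simp add: inv_fourier_def wnorm_def norm_divide norm_mult)

text \<open>With g written as the transform of \<open>inv_fourier g\<close>, the transform of the
  product is a convolution, and Young's inequality for L^1 applies. The factor 2 pi comes from the
  L^1 norm of \<open>inv_fourier g\<close>.\<close>

lemma wnorm_mult_le:
  assumes "f \<in> test_funs UNIV" "g \<in> test_funs UNIV"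
  shows "wnorm (\<lambda>t. f t * g t) \<le> wnorm f * wnorm g / (2 * pi)"
proof -
  let ?\<phi> = "inv_fourier g"
  have f: "integrable lborel f" using test_funs_integrable[OF assms(1)] .
  have ph: "integrable lborel ?\<phi>" using schwartz_integrable[OF inv_fourier_schwartz[OF assms(2)], of 0] by simp
  have ff: "integrable lborel (fourier f)" by (rule integrable_fourier_test_funs[OF assms(1)])
  note [measurable] = borel_measurable_integrable[OF ph, simplified] borel_measurable_integrable[OF ff, simplified]
  have "integrable (lborel \<Otimes>\<^sub>M lborel) (\<lambda>z. norm (case z of (h, x) \<Rightarrow> 1 * (?\<phi> h * fourier f (h - x))))"
    by (intro integrable_norm integrable_convolution_kernel[OF ph ff, where C=1]) auto
  then have i: "integrable (lborel \<Otimes>\<^sub>M lborel) (\<lambda>(h, x). norm (?\<phi> h) * norm (fourier f (h - x)))"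
    by (simp add: norm_mult case_prod_beta')
  have "wnorm (\<lambda>t. f t * g t) = (LINT x|lborel. norm (fourier (\<lambda>t. f t * g t) (- x)))"
    using lborel_integral_real_affine[of "-1" "\<lambda>x. norm (fourier (\<lambda>t. f t * g t) x)" 0] by (simp add: wnorm_def)
  also have "\<dots> = (LINT x|lborel. norm (LINT h|lborel. ?\<phi> h * fourier f (h - x)))"
    using fourier_mult_fourier[OF f ph] by (simp add: fourier_inv_fourier[OF assms(2)])
  also have "\<dots> \<le> (LINT x|lborel. LINT h|lborel. norm (?\<phi> h) * norm (fourier f (h - x)))"
  proof (rule integral_mono_AE')
    show "integrable lborel (\<lambda>x. LINT h|lborel. norm (?\<phi> h) * norm (fourier f (h - x)))"
      by (rule lborel_pair.integrable_snd[OF i])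
    have "norm (LINT h|lborel. ?\<phi> h * fourier f (h - x)) \<le> (LINT h|lborel. norm (?\<phi> h) * norm (fourier f (h - x)))" for x
      using integral_norm_bound[of lborel "\<lambda>h. ?\<phi> h * fourier f (h - x)"] by (simp add: norm_mult)
    then show "AE x in lborel. norm (LINT h|lborel. ?\<phi> h * fourier f (h - x)) \<le> (LINT h|lborel. norm (?\<phi> h) * norm (fourier f (h - x)))"
      by simp
  qed simp
  also have "\<dots> = (LINT h|lborel. LINT x|lborel. norm (?\<phi> h) * norm (fourier f (h - x)))"
    by (rule lborel_pair.Fubini_integral[OF i])
  also have "\<dots> = (LINT h|lborel. norm (?\<phi> h) * wnorm f)"
  proof -
    have "(LINT x|lborel. norm (fourier f (h - x))) = wnorm f" for h
      using lborel_integral_real_affine[of "-1" "\<lambda>x. norm (fourier f x)" h] by (simp add: wnorm_def)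
    then show ?thesis by simp
  qed
  also have "\<dots> = wnorm f * wnorm g / (2 * pi)"
    by (simp add: integral_norm_inv_fourier)
  finally show ?thesis .
qed

section \<open>Pseudomeasures on modulated test functions\<close>

lemma fourier_is_fun_test_funs:
  assumes "fourier_is_fun g F" "\<psi> \<in> test_funs UNIV"
  shows "g \<psi> = (LINT x|lborel. F x * inv_fourier \<psi> x)"
  using assms inv_fourier_schwartz[OF assms(2)] fourier_inv_fourier[OF assms(2)]
  unfolding fourier_is_fun_def fourier_distr_def by metis

text \<open>Duality of L^1 and L^\<infinity>: the constant is sup |F| / (2 pi).\<close>

lemma fourier_is_fun_bound:
  assumes "fourier_is_fun g F"
  obtains C where "C \<ge> 0" "\<And>\<psi>. \<psi> \<in> test_funs UNIV \<Longrightarrow> norm (g \<psi>) \<le> C * wnorm \<psi>"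
proof -
  obtain B where B: "\<And>x. norm (F x) \<le> B" using assms unfolding fourier_is_fun_def bounded_iff by auto
  have B0: "B \<ge> 0" using B[of 0] norm_ge_zero order_trans by blast
  show ?thesis
  proof (rule that[of "B / (2 * pi)"])
    fix \<psi> assume p: "\<psi> \<in> test_funs UNIV"
    have ph: "integrable lborel (inv_fourier \<psi>)" using schwartz_integrable[OF inv_fourier_schwartz[OF p], of 0] by simp
    have "norm (g \<psi>) \<le> (LINT x|lborel. norm (F x * inv_fourier \<psi> x))"
      unfolding fourier_is_fun_test_funs[OF assms p] by (rule integral_norm_bound)
    also have "\<dots> \<le> (LINT x|lborel. B * norm (inv_fourier \<psi> x))"
      using ph by (intro integral_mono_AE') (simp_all add: norm_mult mult_right_mono B B0)
    also have "\<dots> = B / (2 * pi) * wnorm \<psi>"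
      by (simp add: integral_norm_inv_fourier)
    finally show "norm (g \<psi>) \<le> B / (2 * pi) * wnorm \<psi>" .
  qed (use B0 in simp)
qed

text \<open>As a function of h this is a convolution with F. The first form leaves F free of h and
  yields measurability; the second moves h into F, ready for the limit.\<close>

lemma fourier_is_fun_kern_mult:
  assumes "fourier_is_fun g F" "\<psi> \<in> test_funs UNIV"
  shows "g (\<lambda>t. \<psi> t * kern (h * t)) = (LINT x|lborel. F x * (fourier \<psi> (h - x) / (2 * pi)))"
    and "g (\<lambda>t. \<psi> t * kern (h * t)) = (LINT x|lborel. F (h - x) * (fourier \<psi> x / (2 * pi)))"
proof -
  show 1: "g (\<lambda>t. \<psi> t * kern (h * t)) = (LINT x|lborel. F x * (fourier \<psi> (h - x) / (2 * pi)))"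
    using fourier_is_fun_test_funs[OF assms(1) test_funs_mult(1)[OF assms(2) smooth_kern]]
    by (simp add: inv_fourier_def fourier_kern_mult add.commute)
  show "g (\<lambda>t. \<psi> t * kern (h * t)) = (LINT x|lborel. F (h - x) * (fourier \<psi> x / (2 * pi)))"
    unfolding 1
    using lborel_integral_real_affine[of "-1" "\<lambda>x. F x * (fourier \<psi> (h - x) / (2 * pi))" h] by simp
qed

lemma tendsto_convolution_at_infinity:
  fixes F k :: testfun
  assumes F: "F \<in> borel_measurable borel" "\<And>x. norm (F x) \<le> B" "(F \<longlongrightarrow> 0) at_infinity"
    and k: "integrable lborel k"
  shows "((\<lambda>h. LINT x|lborel. F (h - x) * k x) \<longlongrightarrow> 0) at_infinity"
proof -
  note [measurable] = F(1) borel_measurable_integrable[OF k, simplified]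
  \<comment> \<open>The sign s reduces both ends of the line to dominated convergence at plus
    infinity.\<close>
  have t: "((\<lambda>h. LINT x|lborel. F (s * h - x) * k x) \<longlongrightarrow> 0) at_top" if s: "s = 1 \<or> s = -1" for s :: real
  proof -
    have "((\<lambda>h. LINT x|lborel. F (s * h - x) * k x) \<longlongrightarrow> (LINT x|lborel. 0 * k x)) at_top"
    proof (rule integral_dominated_convergence_at_top)
      show "integrable lborel (\<lambda>x. B * norm (k x))" using k by simp
      show "\<forall>\<^sub>F h in at_top. AE x in lborel. norm (F (s * h - x) * k x) \<le> B * norm (k x)"
        by (simp add: norm_mult mult_right_mono F(2))
      show "AE x in lborel. ((\<lambda>h. F (s * h - x) * k x) \<longlongrightarrow> 0 * k x) at_top"
      proof (rule AE_I2)
        fix x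
        have "filterlim (\<lambda>h. s * h - x) at_infinity at_top"
        proof (cases "s = 1")
          case True
          have "filterlim (\<lambda>h. s * h - x) at_top at_top"
            unfolding filterlim_at_top
          proof
            fix Z
            show "\<forall>\<^sub>F h in at_top. Z \<le> s * h - x"
              using eventually_ge_at_top[of "Z + x"] by eventually_elim (use True in simp)
          qed
          then show ?thesis by (rule filterlim_mono[OF _ at_top_le_at_infinity order_refl])
        next
          case False
          have "filterlim (\<lambda>h. s * h - x) at_bot at_top"
            unfolding filterlim_at_bot
          proof
            fix Z
            show "\<forall>\<^sub>F h in at_top. s * h - x \<le> Z"
              using eventually_ge_at_top[of "- (Z + x)"] by eventually_elim (use False s in simp)
          qed
          then show ?thesis by (rule filterlim_mono[OF _ at_bot_le_at_infinity order_refl])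
        qed
        from filterlim_compose[OF F(3) this]
        show "((\<lambda>h. F (s * h - x) * k x) \<longlongrightarrow> 0 * k x) at_top"
          by (intro tendsto_mult tendsto_const)
      qed
    qed measurable
    then show ?thesis by simp
  qed
  have "((\<lambda>h. LINT x|lborel. F (h - x) * k x) \<longlongrightarrow> 0) at_bot"
    using t[of "-1"] by (simp add: filterlim_at_bot_mirror)
  moreover have "((\<lambda>h. LINT x|lborel. F (h - x) * k x) \<longlongrightarrow> 0) at_top"
    using t[of 1] by simp
  ultimately show ?thesis by (simp add: at_infinity_eq_at_top_bot filterlim_sup)
qed

text \<open>Decay of F survives convolution with the integrable function
  \<open>fourier \<psi>\<close>. This disposes of the pieces away from the singular support.\<close>

lemma pseudofunction_kern_mult_tendsto:
  assumes "pseudofunction g" "\<psi> \<in> test_funs UNIV"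
  shows "((\<lambda>h. g (\<lambda>t. \<psi> t * kern (h * t))) \<longlongrightarrow> 0) at_infinity"
proof -
  obtain F where F: "fourier_is_fun g F" "(F \<longlongrightarrow> 0) at_infinity" using assms(1) unfolding pseudofunction_def by blast
  obtain B where B: "\<And>x. norm (F x) \<le> B" using F(1) unfolding fourier_is_fun_def bounded_iff by auto
  have m: "F \<in> borel_measurable borel" using F(1) by (simp add: fourier_is_fun_def)
  show ?thesis
    unfolding fourier_is_fun_kern_mult(2)[OF F(1) assms(2)]
    by (rule tendsto_convolution_at_infinity[OF m B F(2)])
      (use integrable_fourier_test_funs[OF assms(2)] in simp)
qed

section \<open>Second derivatives and the Schwartz seminorms\<close>

lemma nderiv_1_eqI: "(\<And>x. (f has_vector_derivative f' x) (at x)) \<Longrightarrow> nderiv 1 f = f'"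
  by (auto simp: vector_derivative_at)

lemma smooth_has_vector_derivative: "smooth_fun f \<Longrightarrow> (f has_vector_derivative nderiv 1 f x) (at x)"
  using nderiv_has_vector_derivative[of f 0 x] by simp

lemma nderiv_1_mult:
  assumes "smooth_fun f" "smooth_fun g"
  shows "nderiv 1 (\<lambda>x. f x * g x) = (\<lambda>x. f x * nderiv 1 g x + nderiv 1 f x * g x)"
  by (rule nderiv_1_eqI) (intro has_vector_derivative_mult smooth_has_vector_derivative assms)

lemma nderiv_2: "nderiv 2 f = nderiv 1 (nderiv 1 f)"
  by (simp add: numeral_2_eq_2)

lemma nderiv_2_mult:
  assumes "smooth_fun f" "smooth_fun g"
  shows "nderiv 2 (\<lambda>x. f x * g x) =
    (\<lambda>x. (f x * nderiv 2 g x + nderiv 1 f x * nderiv 1 g x) + (nderiv 1 f x * nderiv 1 g x + nderiv 2 f x * g x))"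
  unfolding nderiv_2 nderiv_1_mult[OF assms]
  by (rule nderiv_1_eqI)
    (intro has_vector_derivative_add has_vector_derivative_mult smooth_has_vector_derivative smooth_nderiv assms)

lemma integral_norm_le_support:
  assumes "f \<in> test_funs U" "R \<ge> 0" "\<And>x. \<bar>x\<bar> > R \<Longrightarrow> f x = 0" "\<And>x. norm (f x) \<le> A"
  shows "(LINT x|lborel. norm (f x)) \<le> 2 * R * A"
proof -
  have "(LINT x|lborel. norm (f x)) \<le> (LINT x|lborel. A * indicator {-R..R} x)"
  proof (rule integral_mono)
    show "integrable lborel (\<lambda>x. norm (f x))" using test_funs_integrable[OF assms(1)] by simp
    show "integrable lborel (\<lambda>x. A * indicator {-R..R} x)"
      by (intro integrable_mult_right integrable_real_indicator) (use assms(2) in auto)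
    show "norm (f x) \<le> A * indicator {-R..R} x" for x
      using assms(3)[of x] assms(4)[of x] by (cases "\<bar>x\<bar> > R") (auto simp: indicator_def)
  qed
  also have "\<dots> = 2 * R * A" using assms(2) by simp
  finally show ?thesis .
qed

text \<open>f bounds its transform and f'' bounds x^2 times it; together they give a multiple of the
  integrable function 1/(1 + x^2).\<close>

lemma wnorm_le_support:
  assumes "f \<in> test_funs UNIV" "R \<ge> 0" "\<And>x. \<bar>x\<bar> > R \<Longrightarrow> f x = 0"
    "\<And>x. norm (f x) \<le> A" "\<And>x. norm (nderiv 2 f x) \<le> B"
  shows "wnorm f \<le> 2 * R * (A + B) * (LINT x|lborel. inverse (1 + x\<^sup>2))"
proof -
  have "tsupport f \<subseteq> {-R..R}"
    by (rule tsupport_subsetI) (use assms(3) in force)+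
  moreover have "x \<notin> {-R..R}" if "\<bar>x\<bar> > R" for x using that by auto
  ultimately have z: "nderiv 2 f x = 0" if "\<bar>x\<bar> > R" for x
    using that by (intro nderiv_eq_0_outside_tsupport) blast
  have "norm (fourier f x) \<le> (2 * R * (A + B)) * inverse (1 + x\<^sup>2)" for x
  proof -
    have "norm (fourier f x) \<le> 2 * R * A"
      using norm_fourier_le[of f x] integral_norm_le_support[OF assms(1,2,3,4)] by linarith
    moreover have "x\<^sup>2 * norm (fourier f x) = norm (fourier (nderiv 2 f) x)"
      by (simp only: fourier_nderiv[OF assms(1)]) (simp add: norm_mult norm_power)
    moreover have "norm (fourier (nderiv 2 f) x) \<le> 2 * R * B"
      using norm_fourier_le[of "nderiv 2 f" x]
        integral_norm_le_support[OF test_funs_nderiv[OF assms(1)] assms(2) z assms(5)] by linarith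
    ultimately have "norm (fourier f x) * (1 + x\<^sup>2) \<le> 2 * R * (A + B)"
      by (simp add: algebra_simps)
    moreover have "0 < 1 + x\<^sup>2" by (simp add: add_pos_nonneg)
    ultimately show ?thesis by (simp add: divide_inverse[symmetric] pos_le_divide_eq)
  qed
  then have "wnorm f \<le> (LINT x|lborel. (2 * R * (A + B)) * inverse (1 + x\<^sup>2))"
    unfolding wnorm_def using integrable_fourier_test_funs[OF assms(1)] integrable_cauchy_density
    by (intro integral_mono) simp_all
  then show ?thesis by simp
qed

lemma norm_le_schwartz_seminorm:
  assumes "\<phi> \<in> schwartz"
  shows "norm (nderiv k \<phi> x) \<le> schwartz_seminorm 0 k \<phi>"
proof -
  have "bounded (range (\<lambda>x. complex_of_real x ^ 0 * nderiv k \<phi> x))"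
    using assms unfolding schwartz_def by blast
  then have "bdd_above (range (\<lambda>x. norm (nderiv k \<phi> x)))"
    unfolding bounded_iff bdd_above_def by auto
  from cSUP_upper[OF UNIV_I this, of x] show ?thesis unfolding schwartz_seminorm_def by simp
qed

lemma schwartz_seminorm_nonneg:
  assumes "\<phi> \<in> schwartz"
  shows "schwartz_seminorm m k \<phi> \<ge> 0"
proof -
  have "bounded (range (\<lambda>x. complex_of_real x ^ m * nderiv k \<phi> x))"
    using assms unfolding schwartz_def by blast
  then have "bdd_above (range (\<lambda>x. norm (complex_of_real x ^ m * nderiv k \<phi> x)))"
    unfolding bounded_iff bdd_above_def by auto
  from cSUP_upper[OF UNIV_I this] show ?thesis
    unfolding schwartz_seminorm_def using norm_ge_zero order_trans by blast
qed

text \<open>Supplies the continuity that temperedness of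
  \<open>g (\<lambda>t. \<theta> t * \<phi> t)\<close> in \<open>\<phi>\<close> demands.\<close>

lemma wnorm_mult_schwartz_le:
  assumes th: "\<theta> \<in> test_funs UNIV"
  obtains C where "C \<ge> 0" "\<And>\<phi>. \<phi> \<in> schwartz \<Longrightarrow>
    wnorm (\<lambda>t. \<theta> t * \<phi> t) \<le> C * (\<Sum>m\<le>2. \<Sum>k\<le>2. schwartz_seminorm m k \<phi>)"
proof -
  obtain R where R: "R > 0" "\<And>x. \<bar>x\<bar> > R \<Longrightarrow> \<theta> x = 0" using test_funs_interval[OF th] by metis
  have "\<forall>k. \<exists>B>0. \<forall>x. norm (nderiv k \<theta> x) \<le> B"
    using test_funs_bounded[OF test_funs_nderiv[OF th]] by metis
  then obtain B where B: "\<And>k. B k > 0" "\<And>k x. norm (nderiv k \<theta> x) \<le> B k" by metis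
  define J where "J = (LINT x::real|lborel. inverse (1 + x\<^sup>2))"
  have J: "J \<ge> 0" by (simp add: J_def)
  show ?thesis
  \<comment> \<open>The product itself contributes \<open>B 0\<close>, its second derivative
    \<open>B 0 + 2 * B 1 + B 2\<close> by the Leibniz rule; 2 R is the length of the interval
    carrying \<open>\<theta>\<close>.\<close>
  proof (rule that[of "2 * R * (2 * B 0 + 2 * B 1 + B 2) * J"])
    show "0 \<le> 2 * R * (2 * B 0 + 2 * B 1 + B 2) * J"
      using R J B(1)[of 0] B(1)[of 1] B(1)[of 2] by simp
    fix \<phi> assume p: "\<phi> \<in> schwartz"
    then have sp: "smooth_fun \<phi>" by (simp add: schwartz_def)
    define Q where "Q = (\<Sum>m\<le>(2::nat). \<Sum>k\<le>(2::nat). schwartz_seminorm m k \<phi>)"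
    have Q: "norm (nderiv k \<phi> x) \<le> Q" if "k \<le> 2" for k x
    proof -
      have "schwartz_seminorm 0 k \<phi> \<le> (\<Sum>k\<le>(2::nat). schwartz_seminorm 0 k \<phi>)"
        by (rule member_le_sum) (use that schwartz_seminorm_nonneg[OF p] in auto)
      also have "\<dots> \<le> Q" unfolding Q_def
        by (rule member_le_sum) (use schwartz_seminorm_nonneg[OF p] in \<open>auto intro: sum_nonneg\<close>)
      finally show ?thesis using norm_le_schwartz_seminorm[OF p, of k x] by linarith
    qed
    have prod: "norm (nderiv i \<theta> x * nderiv k \<phi> x) \<le> B i * Q" if "k \<le> 2" for i k x
      unfolding norm_mult using B(2)[of i x] Q[OF that, of x] B(1)[of i]
      by (intro mult_mono) auto
    have "wnorm (\<lambda>t. \<theta> t * \<phi> t) \<le> 2 * R * (B 0 * Q + (B 0 * Q + 2 * B 1 * Q + B 2 * Q)) * J"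
      unfolding J_def
    proof (rule wnorm_le_support)
      show "(\<lambda>t. \<theta> t * \<phi> t) \<in> test_funs UNIV" by (rule test_funs_mult(1)[OF th sp])
      show "\<theta> x * \<phi> x = 0" if "\<bar>x\<bar> > R" for x using R(2)[OF that] by simp
      show "norm (\<theta> x * \<phi> x) \<le> B 0 * Q" for x using prod[of 0 0 x] by simp
      show "norm (nderiv 2 (\<lambda>t. \<theta> t * \<phi> t) x) \<le> B 0 * Q + 2 * B 1 * Q + B 2 * Q" for x
      proof -
        have "norm (\<theta> x * nderiv 2 \<phi> x) \<le> B 0 * Q" using prod[of 2 0 x] by (simp del: nderiv.simps add: nderiv.simps(1))
        moreover have "norm (nderiv 1 \<theta> x * nderiv 1 \<phi> x) \<le> B 1 * Q" by (rule prod) simp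
        moreover have "norm (nderiv 2 \<theta> x * \<phi> x) \<le> B 2 * Q" using prod[of 0 2 x] by (simp del: nderiv.simps add: nderiv.simps(1))
        ultimately show ?thesis
          unfolding nderiv_2_mult[OF test_funsD(1)[OF th] sp]
          by (intro order_trans[OF norm_triangle_ineq] order_trans[OF add_mono[OF norm_triangle_ineq norm_triangle_ineq]]) linarith
      qed
    qed (use R in simp)
    then show "wnorm (\<lambda>t. \<theta> t * \<phi> t) \<le> 2 * R * (2 * B 0 + 2 * B 1 + B 2) * J * (\<Sum>m\<le>2. \<Sum>k\<le>2. schwartz_seminorm m k \<phi>)"
      unfolding Q_def[symmetric] by (simp add: algebra_simps)
  qed
qed

text \<open>Formally \<open>fourier \<phi>\<close> superposes the characters e_h with weights
  \<open>\<phi> h\<close>, and pulling g inside gives the claimed Fourier transform. Passing through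
  F makes this exact: the transform of \<open>\<theta>\<close> times \<open>fourier \<phi>\<close>
  is a convolution, and Fubini collects the integral over x into the value of g at
  \<open>\<theta>\<close> e_h. The factor \<open>\<theta>\<close> turns e_h into a test
  function.\<close>

lemma pseudomeasure_mult_test_fun:
  assumes g: "pseudomeasure g" and th: "\<theta> \<in> test_funs UNIV"
  shows "tempered (\<lambda>\<phi>. g (\<lambda>t. \<theta> t * \<phi> t))"
    and "fourier_is_fun (\<lambda>\<phi>. g (\<lambda>t. \<theta> t * \<phi> t)) (\<lambda>h. g (\<lambda>t. \<theta> t * kern (h * t)))"
proof -
  obtain F where F: "fourier_is_fun g F" using g unfolding pseudomeasure_def by blast
  obtain C where C: "C \<ge> 0" "\<And>\<psi>. \<psi> \<in> test_funs UNIV \<Longrightarrow> norm (g \<psi>) \<le> C * wnorm \<psi>"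
    using fourier_is_fun_bound[OF F] by metis
  obtain D where D: "D \<ge> 0" "\<And>\<phi>. \<phi> \<in> schwartz \<Longrightarrow>
    wnorm (\<lambda>t. \<theta> t * \<phi> t) \<le> D * (\<Sum>m\<le>2. \<Sum>k\<le>2. schwartz_seminorm m k \<phi>)"
    by (rule wnorm_mult_schwartz_le[OF th]) (rule that)
  have lin: "linear_on schwartz g" using g by (simp add: pseudomeasure_def tempered_def)
  have t: "(\<lambda>t. \<theta> t * \<phi> t) \<in> test_funs UNIV" if "smooth_fun \<phi>" for \<phi>
    by (rule test_funs_mult(1)[OF th that])
  have lin': "linear_on schwartz (\<lambda>\<phi>. g (\<lambda>t. \<theta> t * \<phi> t))"
    unfolding linear_on_def
  proof (intro ballI allI)
    fix \<phi> \<psi> :: testfun and a b :: complex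
    assume "\<phi> \<in> schwartz" "\<psi> \<in> schwartz"
    then have "smooth_fun \<phi>" "smooth_fun \<psi>" by (simp_all add: schwartz_def)
    note * = test_funs_schwartz[OF t[OF this(1)]] test_funs_schwartz[OF t[OF this(2)]]
    have e: "(\<lambda>t. \<theta> t * (a * \<phi> t + b * \<psi> t)) = (\<lambda>t. a * (\<theta> t * \<phi> t) + b * (\<theta> t * \<psi> t))"
      by (simp add: algebra_simps)
    show "g (\<lambda>t. \<theta> t * (a * \<phi> t + b * \<psi> t)) = a * g (\<lambda>t. \<theta> t * \<phi> t) + b * g (\<lambda>t. \<theta> t * \<psi> t)"
      unfolding e by (rule linear_onD[OF lin *])
  qed
  have bnd: "norm (g (\<lambda>t. \<theta> t * \<phi> t)) \<le> (C * D) * (\<Sum>m\<le>2. \<Sum>k\<le>2. schwartz_seminorm m k \<phi>)"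
    if "\<phi> \<in> schwartz" for \<phi>
  proof -
    have "smooth_fun \<phi>" using that by (simp add: schwartz_def)
    then have "norm (g (\<lambda>t. \<theta> t * \<phi> t)) \<le> C * wnorm (\<lambda>t. \<theta> t * \<phi> t)" by (rule C(2)[OF t])
    also have "\<dots> \<le> C * (D * (\<Sum>m\<le>2. \<Sum>k\<le>2. schwartz_seminorm m k \<phi>))"
      by (rule mult_left_mono[OF D(2)[OF that] C(1)])
    finally show ?thesis by (simp add: mult.assoc)
  qed
  show "tempered (\<lambda>\<phi>. g (\<lambda>t. \<theta> t * \<phi> t))"
    unfolding tempered_def
  proof (intro conjI exI[of _ "C * D"] exI[of _ 2] ballI)
    fix \<phi> assume "\<phi> \<in> schwartz"
    then show "norm (g (\<lambda>t. \<theta> t * \<phi> t)) \<le> (C * D) * (\<Sum>m\<le>2. \<Sum>k\<le>2. schwartz_seminorm m k \<phi>)"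
      by (rule bnd)
  qed (rule lin')
  let ?F1 = "\<lambda>h. g (\<lambda>t. \<theta> t * kern (h * t))"
  obtain B where B: "\<And>x. norm (F x) \<le> B" using F unfolding fourier_is_fun_def bounded_iff by auto
  have Fm: "F \<in> borel_measurable borel" using F by (simp add: fourier_is_fun_def)
  have thmeas: "\<theta> \<in> borel_measurable borel" by (rule test_funs_measurable[OF th])
  have F1: "?F1 h = (LINT x|lborel. F x * (fourier \<theta> (h - x) / (2 * pi)))" for h
    by (rule fourier_is_fun_kern_mult(1)[OF F th])
  note [measurable] = Fm thmeas
  have "?F1 \<in> borel_measurable borel" unfolding F1 by measurable
  moreover have "norm (?F1 h) \<le> C * wnorm \<theta>" for h
    using C(2)[OF test_funs_mult(1)[OF th smooth_kern], of h] by (simp add: wnorm_kern_mult)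
  then have "bounded (range ?F1)" unfolding bounded_iff by blast
  moreover have "g (\<lambda>t. \<theta> t * fourier \<phi> t) = (LINT h|lborel. ?F1 h * \<phi> h)" if p: "\<phi> \<in> schwartz" for \<phi>
  proof -
    have ip: "integrable lborel \<phi>" using schwartz_integrable[OF p, of 0] by simp
    have "g (\<lambda>t. \<theta> t * fourier \<phi> t) = (LINT x|lborel. F x * inv_fourier (\<lambda>t. \<theta> t * fourier \<phi> t) x)"
      by (rule fourier_is_fun_test_funs[OF F t[OF smooth_fourier_schwartz[OF p]]])
    also have "\<dots> = (LINT x|lborel. LINT h|lborel. (F x / (2 * pi)) * (\<phi> h * fourier \<theta> (h - x)))"
      by (simp add: inv_fourier_def fourier_mult_fourier[OF test_funs_integrable[OF th] ip])
    also have "\<dots> = (LINT h|lborel. LINT x|lborel. (F x / (2 * pi)) * (\<phi> h * fourier \<theta> (h - x)))"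
    proof (rule lborel_pair.Fubini_integral)
      show "integrable (lborel \<Otimes>\<^sub>M lborel) (\<lambda>(h, x). (F x / (2 * pi)) * (\<phi> h * fourier \<theta> (h - x)))"
        by (rule integrable_convolution_kernel[OF ip integrable_fourier_test_funs[OF th], where C="B / (2 * pi)"])
          (simp_all add: norm_divide norm_mult divide_right_mono B)
    qed
    also have "\<dots> = (LINT h|lborel. ?F1 h * \<phi> h)"
    proof (rule Bochner_Integration.integral_cong[OF refl])
      fix h
      have "(LINT x|lborel. (F x / (2 * pi)) * (\<phi> h * fourier \<theta> (h - x)))
        = (LINT x|lborel. (F x * (fourier \<theta> (h - x) / (2 * pi))) * \<phi> h)"
        by (rule Bochner_Integration.integral_cong) (simp_all add: mult_ac)
      then show "(LINT x|lborel. (F x / (2 * pi)) * (\<phi> h * fourier \<theta> (h - x))) = ?F1 h * \<phi> h"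
        by (simp only: F1 integral_mult_left_zero)
    qed
    finally show ?thesis .
  qed
  ultimately show "fourier_is_fun (\<lambda>\<phi>. g (\<lambda>t. \<theta> t * \<phi> t)) ?F1"
    unfolding fourier_is_fun_def fourier_distr_def by simp
qed

section \<open>Decay away from and near a compact null set\<close>

lemma mult_tent_eq_0_outside:
  assumes "d > 0" "\<psi> t * tent ((1 / d) * t + (- of_int j)) \<noteq> 0"
  shows "t \<in> tsupport \<psi>" "\<bar>t - of_int j * d\<bar> \<le> d"
proof -
  show "t \<in> tsupport \<psi>" using assms(2) tsupport_nonzero[of \<psi> t] by auto
  have "\<bar>(1 / d) * t + (- of_int j)\<bar> < 1" using assms(2) tent_eq_0[of "(1 / d) * t + (- of_int j)"] by fastforce
  moreover have "(1 / d) * t + (- of_int j) = (t - of_int j * d) / d" using assms(1) by (simp add: field_simps)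
  ultimately show "\<bar>t - of_int j * d\<bar> \<le> d" using assms(1) by (simp add: abs_divide divide_less_eq)
qed

lemma tsupport_mult_tent:
  assumes "d > 0"
  shows "tsupport (\<lambda>t. \<psi> t * tent ((1 / d) * t + (- of_int j))) \<subseteq> tsupport \<psi> \<inter> cball (of_int j * d) d"
  using mult_tent_eq_0_outside[OF assms, of \<psi> _ j]
  by (intro tsupport_subsetI) (auto simp: closed_tsupport closed_Int dist_real_def abs_minus_commute)

lemma smooth_scaled_tent: "smooth_fun (\<lambda>t. tent (a * t + b))"
  by (rule smooth_affine[OF smooth_tent])

text \<open>N is obtained before T and k because it depends on \<open>\<psi>\<close> and d alone:
  with k = e_h the number of terms stays fixed while h tends to infinity.\<close>

lemma tent_decomposition:
  assumes "\<psi> \<in> test_funs U" "d > 0"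
  obtains N :: nat where "\<And>T k. linear_on (test_funs U) T \<Longrightarrow> smooth_fun k \<Longrightarrow>
    T (\<lambda>t. \<psi> t * k t) = (\<Sum>j\<in>{- int N..int N}. T (\<lambda>t. (\<psi> t * tent ((1 / d) * t + (- of_int j))) * k t))"
proof -
  obtain R where R: "\<And>x. \<bar>x\<bar> > R \<Longrightarrow> \<psi> x = 0" using test_funs_interval[OF assms(1)] by metis
  obtain N0 :: nat where N0: "R / d + 1 \<le> real N0" using real_arch_simple by blast
  define N where "N = Suc N0"
  have N: "N > 0" "R / d \<le> real N - 1" using N0 by (auto simp: N_def)
  show ?thesis
  proof (rule that[of N])
    fix T :: distr and k :: testfun assume T: "linear_on (test_funs U) T" and k: "smooth_fun k"
    have "\<psi> t * k t = (\<Sum>j\<in>{- int N..int N}. (\<psi> t * tent ((1 / d) * t + (- of_int j))) * k t)" for t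
    proof (cases "\<bar>t\<bar> > R")
      case False
      then have "\<bar>t / d\<bar> \<le> real N - 1"
        using N(2) assms(2) divide_right_mono[of "\<bar>t\<bar>" R d] by (simp add: abs_divide)
      from sum_tent[OF N(1) this] have "(\<Sum>j\<in>{- int N..int N}. tent ((1 / d) * t + (- of_int j))) = 1" by simp
      then have "\<psi> t * (\<Sum>j\<in>{- int N..int N}. tent ((1 / d) * t + (- of_int j))) * k t = \<psi> t * k t" by simp
      then show ?thesis by (simp only: sum_distrib_left sum_distrib_right)
    qed (simp add: R)
    then have e: "(\<lambda>t. \<psi> t * k t) = (\<lambda>t. \<Sum>j\<in>{- int N..int N}. (\<psi> t * tent ((1 / d) * t + (- of_int j))) * k t)"
      by (rule ext)
    show "T (\<lambda>t. \<psi> t * k t) = (\<Sum>j\<in>{- int N..int N}. T (\<lambda>t. (\<psi> t * tent ((1 / d) * t + (- of_int j))) * k t))"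
      unfolding e
      by (rule linear_on_sum[OF T]) (rule test_funs_mult(1)[OF test_funs_mult(1)[OF assms(1) smooth_scaled_tent] k])
  qed
qed

text \<open>In contrast to \<open>local_pseudofunction\<close>, one g serves all of W, so a piece
  supported in W needs no further splitting.\<close>

definition pf_near :: "distr \<Rightarrow> real set \<Rightarrow> bool" where
  "pf_near f W \<longleftrightarrow> open W \<and> (\<exists>g. pseudofunction g \<and> (\<forall>\<phi>\<in>test_funs W. f \<phi> = g \<phi>))"

lemma pf_near_tendsto:
  assumes lin: "linear_on (test_funs U) f" and psi: "\<psi> \<in> test_funs U"
    and loc: "\<And>x. x \<in> tsupport \<psi> \<Longrightarrow> \<exists>W. x \<in> W \<and> pf_near f W"
  shows "((\<lambda>h. f (\<lambda>t. \<psi> t * kern (h * t))) \<longlongrightarrow> 0) at_infinity"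
proof -
  obtain e where e: "e > 0" "\<And>x. x \<in> tsupport \<psi> \<Longrightarrow> \<exists>G. pf_near f G \<and> ball x e \<subseteq> G"
  proof (rule Heine_Borel_lemma[of "tsupport \<psi>" "Collect (pf_near f)"])
    show "compact (tsupport \<psi>)" by (rule test_funsD(2)[OF psi])
    show "tsupport \<psi> \<subseteq> \<Union> (Collect (pf_near f))" using loc by auto
    show "open G" if "G \<in> Collect (pf_near f)" for G using that by (simp add: pf_near_def)
  qed (use that in auto)
  \<comment> \<open>Here e is a Lebesgue number of the cover. A piece is supported in a ball of
    radius d, so two points of its support are at most 2 d = e/2 apart and the whole support lies in
    one set of the cover.\<close>
  define d where "d = e / 4"
  have d: "d > 0" using e by (simp add: d_def)
  obtain N :: nat where N: "\<And>T k. linear_on (test_funs U) T \<Longrightarrow> smooth_fun k \<Longrightarrow>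
    T (\<lambda>t. \<psi> t * k t) = (\<Sum>j\<in>{- int N..int N}. T (\<lambda>t. (\<psi> t * tent ((1 / d) * t + (- of_int j))) * k t))"
    by (rule tent_decomposition[OF psi d]) (rule that)
  have "((\<lambda>h. f (\<lambda>t. (\<psi> t * tent ((1 / d) * t + (- of_int j))) * kern (h * t))) \<longlongrightarrow> 0) at_infinity" for j
  proof -
    let ?\<psi> = "\<lambda>t. \<psi> t * tent ((1 / d) * t + (- of_int j))"
    have p: "?\<psi> \<in> test_funs U" by (rule test_funs_mult(1)[OF psi smooth_scaled_tent])
    note ts = tsupport_mult_tent[OF d, of \<psi> j]
    show ?thesis
    proof (cases "tsupport ?\<psi> = {}")
      case True
      have z: "?\<psi> t = 0" for t using tsupport_nonzero[of ?\<psi> t] True by blast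
      have "(\<lambda>t. ?\<psi> t * kern (h * t)) = (\<lambda>_. 0)" for h unfolding z by simp
      then show ?thesis using linear_on_zero[OF lin] by simp
    next
      case False
      then obtain x where x: "x \<in> tsupport ?\<psi>" by blast
      then have "x \<in> tsupport \<psi>" using ts by blast
      from e(2)[OF this] obtain G where G: "pf_near f G" "ball x e \<subseteq> G" by blast
      have "tsupport ?\<psi> \<subseteq> ball x e"
      proof
        fix y assume "y \<in> tsupport ?\<psi>"
        then have "dist (of_int j * d) y \<le> d" using ts by auto
        moreover have "dist (of_int j * d) x \<le> d" using ts x by auto
        ultimately have "dist x y \<le> d + d" by (metis add_mono dist_commute dist_triangle order_trans)
        then show "y \<in> ball x e" using e(1) by (simp add: d_def)
      qed
      then have pG: "?\<psi> \<in> test_funs G" using G(2) test_funsD[OF p] by (auto simp: test_funs_def)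
      obtain g where g: "pseudofunction g" "\<And>\<phi>. \<phi> \<in> test_funs G \<Longrightarrow> f \<phi> = g \<phi>"
        using G(1) unfolding pf_near_def by blast
      have "f (\<lambda>t. ?\<psi> t * kern (h * t)) = g (\<lambda>t. ?\<psi> t * kern (h * t))" for h
        by (rule g(2)[OF test_funs_mult(1)[OF pG smooth_kern]])
      then show ?thesis using pseudofunction_kern_mult_tendsto[OF g(1) test_funs_UNIV[OF p]] by simp
    qed
  qed
  then have "((\<lambda>h. \<Sum>j\<in>{- int N..int N}. f (\<lambda>t. (\<psi> t * tent ((1 / d) * t + (- of_int j))) * kern (h * t)))
     \<longlongrightarrow> (\<Sum>j\<in>{- int N..int N}. 0)) at_infinity"
    by (rule tendsto_sum)
  then show ?thesis unfolding N[OF lin smooth_kern] by simp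
qed

section \<open>Counting cells near a compact null set\<close>

lemma card_intervals_le:
  fixes J :: "int set"
  assumes "finite J" "d > 0" "V \<in> sets lborel" "emeasure lborel V \<le> ennreal \<eta>" "\<eta> \<ge> 0"
    and sub: "\<And>j. j \<in> J \<Longrightarrow> {of_int j * d..<of_int (j + 1) * d} \<subseteq> V"
  shows "real (card J) * d \<le> \<eta>"
proof -
  let ?I = "\<lambda>j::int. {of_int j * d..<of_int (j + 1) * d}"
  \<comment> \<open>Half-open cells are disjoint, so their number times d is exactly the measure of
    their union.\<close>
  have "disjoint_family_on ?I J"
    unfolding disjoint_family_on_def
  proof (intro ballI impI)
    fix i j :: int assume "i \<noteq> j"
    then consider "i + 1 \<le> j" | "j + 1 \<le> i" by linarith
    then show "?I i \<inter> ?I j = {}"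
    proof cases
      case 1
      then have "of_int (i + 1) * d \<le> of_int j * d" using assms(2) by (intro mult_right_mono) auto
      then show ?thesis by auto
    next
      case 2
      then have "of_int (j + 1) * d \<le> of_int i * d" using assms(2) by (intro mult_right_mono) auto
      then show ?thesis by auto
    qed
  qed
  then have "emeasure lborel (\<Union>j\<in>J. ?I j) = (\<Sum>j\<in>J. emeasure lborel (?I j))"
    using assms(1) by (intro sum_emeasure[symmetric]) auto
  also have "\<dots> = (\<Sum>j\<in>J. ennreal d)"
    using assms(2) by (intro sum.cong) (auto simp: algebra_simps)
  also have "\<dots> = ennreal (real (card J) * d)"
    using assms(2) by (simp add: ennreal_of_nat_eq_real_of_nat ennreal_mult)
  finally have "ennreal (real (card J) * d) = emeasure lborel (\<Union>j\<in>J. ?I j)" by simp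
  also have "\<dots> \<le> emeasure lborel V" using sub assms(3) by (intro emeasure_mono) auto
  also have "\<dots> \<le> ennreal \<eta>" by fact
  finally show ?thesis using assms(5) by (simp add: ennreal_le_iff)
qed

text \<open>Outer regularity puts K into an open V of measure at most \<open>\<eta>\<close>;
  compactness gives a uniform distance e by which V surrounds K. Cells small against e and close to
  K then lie in V.\<close>

lemma null_compact_tent_cover:
  assumes "compact K" "K \<in> null_sets lborel" "\<eta> > 0"
  obtains d where "d > 0"
    "\<And>J. finite J \<Longrightarrow> (\<And>j. j \<in> J \<Longrightarrow> \<exists>t0\<in>K. \<bar>t0 - of_int j * d\<bar> \<le> 2 * d) \<Longrightarrow> real (card J) * d \<le> \<eta>"
proof -
  have Ks: "K \<in> sets borel" "emeasure lborel K = 0" using assms(2) by auto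
  obtain V where V: "open V" "K \<subseteq> V" "emeasure lborel (V - K) < ennreal \<eta>"
    using outer_regular_lborel[of K \<eta>] Ks assms(3) by auto
  have mO: "emeasure lborel V \<le> ennreal \<eta>"
  proof -
    have "emeasure lborel V \<le> emeasure lborel ((V - K) \<union> K)" using V Ks by (intro emeasure_mono) auto
    also have "\<dots> \<le> emeasure lborel (V - K) + emeasure lborel K" using V Ks by (intro emeasure_subadditive) auto
    finally show ?thesis using V(3) Ks(2) by (simp add: less_imp_le order_trans)
  qed
  obtain e where e: "e > 0" "\<And>x. x \<in> K \<Longrightarrow> ball x e \<subseteq> V"
    by (rule Heine_Borel_lemma[of K "{V}"]) (use assms(1) V in auto)
  show ?thesis
  proof (rule that[of "e / 4"])
    fix J :: "int set" assume J: "finite J" "\<And>j. j \<in> J \<Longrightarrow> \<exists>t0\<in>K. \<bar>t0 - of_int j * (e / 4)\<bar> \<le> 2 * (e / 4)"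
    show "real (card J) * (e / 4) \<le> \<eta>"
    proof (rule card_intervals_le[OF J(1)])
      fix j assume "j \<in> J"
      with J(2) obtain t0 where t0: "t0 \<in> K" "\<bar>t0 - of_int j * (e / 4)\<bar> \<le> 2 * (e / 4)" by blast
      \<comment> \<open>With d = e/4, a point of the cell has distance at most 2 d + d < e from
        t0.\<close>
      have "{of_int j * (e / 4)..<of_int (j + 1) * (e / 4)} \<subseteq> ball t0 e"
      proof
        fix x assume "x \<in> {of_int j * (e / 4)..<of_int (j + 1) * (e / 4)}"
        then have "of_int j * (e / 4) \<le> x" "x < of_int j * (e / 4) + e / 4" by (auto simp: algebra_simps)
        then show "x \<in> ball t0 e" using t0(2) unfolding mem_ball dist_real_def by linarith
      qed
      then show "{of_int j * (e / 4)..<of_int (j + 1) * (e / 4)} \<subseteq> V" using e(2)[OF t0(1)] by blast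
    qed (use e(1) V(1) mO assms(3) in auto)
  qed (use e(1) in simp)
qed

text \<open>In the variable s = t/d - j one has t - t0 = d s + (j d - t0), and both coefficients are
  O(d). So the linear factor times the tent is a rescaled copy of u, a combination of two fixed
  profiles with coefficients O(d); the cutoff costs a constant and the character nothing.\<close>

lemma wnorm_sub_mult_tent_le:
  assumes chi: "\<kappa> \<in> test_funs UNIV" and d: "d > 0" and t0: "\<bar>t0 - of_int j * d\<bar> \<le> 2 * d"
  shows "wnorm (\<lambda>t. complex_of_real (t - t0) * ((\<kappa> t * tent ((1 / d) * t + (- of_int j))) * kern (h * t)))
    \<le> wnorm \<kappa> / (2 * pi) * (wnorm (\<lambda>s. complex_of_real s * tent s) + 2 * wnorm tent) * d"
proof -
  define u :: testfun where "u s = complex_of_real d * (complex_of_real s * tent s) + complex_of_real (of_int j * d - t0) * tent s" for s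
  have x: "(\<lambda>s. complex_of_real s * tent s) \<in> test_funs UNIV"
    using test_funs_mult(2)[OF tent_test_funs smooth_of_real_power[of 1]] by simp
  have u1: "(\<lambda>s. complex_of_real d * (complex_of_real s * tent s)) \<in> test_funs UNIV" by (rule test_funs_cmult[OF x])
  have u2: "(\<lambda>s. complex_of_real (of_int j * d - t0) * tent s) \<in> test_funs UNIV" by (rule test_funs_cmult[OF tent_test_funs])
  have eq: "complex_of_real (t - t0) * ((\<kappa> t * tent ((1 / d) * t + (- of_int j))) * kern (h * t))
     = (\<kappa> t * u ((1 / d) * t + (- of_int j))) * kern (h * t)" for t
  proof -
    have "u ((1 / d) * t + (- of_int j)) = complex_of_real (d * ((1 / d) * t + (- of_int j)) + (of_int j * d - t0)) * tent ((1 / d) * t + (- of_int j))"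
      unfolding u_def of_real_add of_real_mult by (simp only: distrib_right mult.assoc)
    also have "d * ((1 / d) * t + (- of_int j)) + (of_int j * d - t0) = t - t0" using d by (simp add: field_simps)
    finally show ?thesis by (simp only: mult_ac)
  qed
  have "wnorm u \<le> wnorm (\<lambda>s. complex_of_real d * (complex_of_real s * tent s)) + wnorm (\<lambda>s. complex_of_real (of_int j * d - t0) * tent s)"
    unfolding u_def[abs_def] by (rule wnorm_add_le[OF u1 u2])
  also have "\<dots> = d * wnorm (\<lambda>s. complex_of_real s * tent s) + \<bar>of_int j * d - t0\<bar> * wnorm tent"
    using d by (simp only: wnorm_cmult norm_of_real abs_of_pos)
  also have "\<dots> \<le> d * wnorm (\<lambda>s. complex_of_real s * tent s) + (2 * d) * wnorm tent"
    using t0 by (intro add_left_mono mult_right_mono wnorm_nonneg) (simp add: abs_minus_commute)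
  finally have wu: "wnorm u \<le> (wnorm (\<lambda>s. complex_of_real s * tent s) + 2 * wnorm tent) * d"
    by (simp add: algebra_simps)
  have ut: "u \<in> test_funs UNIV" unfolding u_def[abs_def] by (rule test_funs_add[OF u1 u2])
  have v: "(\<lambda>t. u ((1 / d) * t + (- of_int j))) \<in> test_funs UNIV"
  proof (rule test_funsI)
    show "smooth_fun (\<lambda>t. u ((1 / d) * t + (- of_int j)))" by (rule smooth_affine[OF test_funsD(1)[OF ut]])
    show "t \<in> cball (of_int j * d) d" if "u ((1 / d) * t + (- of_int j)) \<noteq> 0" for t
    proof -
      have "1 * tent ((1 / d) * t + (- of_int j)) \<noteq> 0" using that by (auto simp: u_def)
      from mult_tent_eq_0_outside(2)[OF d this] show ?thesis by (simp add: dist_real_def abs_minus_commute)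
    qed
  qed auto
  have "wnorm (\<lambda>t. complex_of_real (t - t0) * ((\<kappa> t * tent ((1 / d) * t + (- of_int j))) * kern (h * t)))
    = wnorm (\<lambda>t. \<kappa> t * u ((1 / d) * t + (- of_int j)))"
    unfolding eq by (rule wnorm_kern_mult)
  also have "\<dots> \<le> wnorm \<kappa> * wnorm (\<lambda>t. u ((1 / d) * t + (- of_int j))) / (2 * pi)"
    by (rule wnorm_mult_le[OF chi v])
  also have "wnorm (\<lambda>t. u ((1 / d) * t + (- of_int j))) = wnorm u"
    by (rule wnorm_affine) (use d in simp)
  also have "wnorm \<kappa> * wnorm u / (2 * pi) = wnorm \<kappa> / (2 * pi) * wnorm u" by simp
  also have "\<dots> \<le> wnorm \<kappa> / (2 * pi) * ((wnorm (\<lambda>s. complex_of_real s * tent s) + 2 * wnorm tent) * d)"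
    by (rule mult_left_mono[OF wu]) (simp add: wnorm_nonneg)
  finally show ?thesis by (simp only: mult.assoc)
qed

lemma sum_diff_bound_tendsto:
  fixes F G :: testfun
  assumes G: "(G \<longlongrightarrow> 0) at_infinity" and le: "\<And>h. norm (F h - G h) \<le> e / 2" and e: "e > 0"
  shows "\<forall>\<^sub>F h in at_infinity. norm (F h) < e"
proof -
  have "\<forall>\<^sub>F h in at_infinity. norm (G h) < e / 2"
    using tendstoD[OF G, of "e / 2"] e by simp
  then show ?thesis
  proof eventually_elim
    case (elim h)
    then show ?case using le[of h] norm_triangle_ineq[of "F h - G h" "G h"] by simp
  qed
qed

text \<open>The width d is chosen from \<open>\<epsilon>\<close> first. The sum near K is then at
  most \<open>\<epsilon> / 2\<close> for all h at once, because M does not depend on the point of K;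
  the remaining sum is finite and tends to 0.\<close>

lemma kern_mult_tendsto_zero:
  assumes lin: "linear_on (test_funs U) f" and kap: "\<kappa> \<in> test_funs U"
    and K: "compact K" "K \<in> null_sets lborel" and M: "M \<ge> 0"
    and bound: "\<And>t0 \<phi>. t0 \<in> K \<Longrightarrow> \<phi> \<in> test_funs U \<Longrightarrow> tsupport \<phi> \<subseteq> tsupport \<kappa> \<Longrightarrow>
      norm (f \<phi>) \<le> M * wnorm (\<lambda>t. complex_of_real (t - t0) * \<phi> t)"
    and loc: "\<And>x. x \<in> tsupport \<kappa> \<Longrightarrow> x \<notin> K \<Longrightarrow> \<exists>W. x \<in> W \<and> pf_near f W"
  shows "((\<lambda>h. f (\<lambda>t. \<kappa> t * kern (h * t))) \<longlongrightarrow> 0) at_infinity"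
proof (rule tendstoI)
  fix \<epsilon> :: real assume eps: "\<epsilon> > 0"
  define C where "C = M * (wnorm \<kappa> / (2 * pi) * (wnorm (\<lambda>s. complex_of_real s * tent s) + 2 * wnorm tent))"
  have C: "C \<ge> 0" using M by (simp add: C_def wnorm_nonneg)
  \<comment> \<open>The \<open>+ 1\<close> keeps the quotient meaningful for C = 0, and C / (C + 1)
    \<le> 1 restores \<open>\<epsilon> / 2\<close> at the end.\<close>
  have "\<epsilon> / 2 / (C + 1) > 0" using eps C by simp
  from null_compact_tent_cover[OF K this]
  obtain d where d: "d > 0" and card: "\<And>J. finite J \<Longrightarrow> (\<And>j. j \<in> J \<Longrightarrow> \<exists>t0\<in>K. \<bar>t0 - of_int j * d\<bar> \<le> 2 * d)
      \<Longrightarrow> real (card J) * d \<le> \<epsilon> / 2 / (C + 1)" by blast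
  let ?\<kappa> = "\<lambda>j t. \<kappa> t * tent ((1 / d) * t + (- of_int j))"
  obtain N :: nat where N: "\<And>T k. linear_on (test_funs U) T \<Longrightarrow> smooth_fun k \<Longrightarrow>
    T (\<lambda>t. \<kappa> t * k t) = (\<Sum>j\<in>{- int N..int N}. T (\<lambda>t. ?\<kappa> j t * k t))"
    by (rule tent_decomposition[OF kap d]) (rule that)
  have kj: "?\<kappa> j \<in> test_funs U" for j by (rule test_funs_mult(1)[OF kap smooth_scaled_tent])
  define J where "J = {j \<in> {- int N..int N}. \<exists>t0\<in>K. \<bar>t0 - of_int j * d\<bar> \<le> 2 * d}"
  have J: "J \<subseteq> {- int N..int N}" "finite J"
  proof -
    show "J \<subseteq> {- int N..int N}" by (auto simp: J_def)
    then show "finite J" by (rule finite_subset) simp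
  qed
  let ?near = "\<lambda>h. \<Sum>j\<in>J. f (\<lambda>t. ?\<kappa> j t * kern (h * t))"
  let ?far = "\<lambda>h. \<Sum>j\<in>{- int N..int N} - J. f (\<lambda>t. ?\<kappa> j t * kern (h * t))"
  have far: "(?far \<longlongrightarrow> 0) at_infinity"
  proof -
    have "((\<lambda>h. f (\<lambda>t. ?\<kappa> j t * kern (h * t))) \<longlongrightarrow> 0) at_infinity" if j: "j \<in> {- int N..int N} - J" for j
    proof (rule pf_near_tendsto[OF lin kj])
      fix x assume "x \<in> tsupport (?\<kappa> j)"
      then have x: "x \<in> tsupport \<kappa>" "\<bar>x - of_int j * d\<bar> \<le> d"
        using tsupport_mult_tent[OF d, of \<kappa> j] by (auto simp: dist_real_def abs_minus_commute)
      have "x \<notin> K"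
      proof
        assume "x \<in> K"
        moreover have "\<bar>x - of_int j * d\<bar> \<le> 2 * d" using x(2) d by linarith
        ultimately have "j \<in> J" using j unfolding J_def by blast
        then show False using j by simp
      qed
      then show "\<exists>W. x \<in> W \<and> pf_near f W" by (rule loc[OF x(1)])
    qed
    then have "(?far \<longlongrightarrow> (\<Sum>j\<in>{- int N..int N} - J. 0)) at_infinity" by (rule tendsto_sum)
    then show ?thesis by simp
  qed
  have near: "norm (?near h) \<le> \<epsilon> / 2" for h
  proof -
    have "norm (f (\<lambda>t. ?\<kappa> j t * kern (h * t))) \<le> C * d" if j: "j \<in> J" for j
    proof -
      obtain t0 where t0: "t0 \<in> K" "\<bar>t0 - of_int j * d\<bar> \<le> 2 * d" using j unfolding J_def by blast
      have "norm (f (\<lambda>t. ?\<kappa> j t * kern (h * t))) \<le> M * wnorm (\<lambda>t. complex_of_real (t - t0) * (?\<kappa> j t * kern (h * t)))"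
      proof (rule bound[OF t0(1) test_funs_mult(1)[OF kj smooth_kern]])
        show "tsupport (\<lambda>t. ?\<kappa> j t * kern (h * t)) \<subseteq> tsupport \<kappa>"
        proof (rule tsupport_subsetI[OF closed_tsupport])
          fix t assume "?\<kappa> j t * kern (h * t) \<noteq> 0"
          then have "\<kappa> t \<noteq> 0" by auto
          then show "t \<in> tsupport \<kappa>" by (rule tsupport_nonzero)
        qed
      qed
      also have "\<dots> \<le> M * (wnorm \<kappa> / (2 * pi) * (wnorm (\<lambda>s. complex_of_real s * tent s) + 2 * wnorm tent) * d)"
        by (rule mult_left_mono[OF wnorm_sub_mult_tent_le[OF test_funs_UNIV[OF kap] d t0(2)] M])
      also have "\<dots> = C * d" by (simp only: C_def mult.assoc)
      finally show ?thesis .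
    qed
    then have "norm (?near h) \<le> (\<Sum>j\<in>J. C * d)" by (rule sum_norm_le)
    also have "\<dots> = C * (real (card J) * d)" by simp
    also have "\<dots> \<le> C * (\<epsilon> / 2 / (C + 1))"
      by (intro mult_left_mono[OF _ C] card J(2)) (auto simp: J_def)
    also have "\<dots> \<le> \<epsilon> / 2" using C eps by (simp add: field_simps)
    finally show ?thesis .
  qed
  have "f (\<lambda>t. \<kappa> t * kern (h * t)) = ?far h + ?near h" for h
    unfolding N[OF lin smooth_kern] by (rule sum.subset_diff) (use J in auto)
  then have "norm (f (\<lambda>t. \<kappa> t * kern (h * t)) - ?far h) \<le> \<epsilon> / 2" for h
    using near[of h] by simp
  from sum_diff_bound_tendsto[OF far this eps]
  show "\<forall>\<^sub>F h in at_infinity. dist (f (\<lambda>t. \<kappa> t * kern (h * t))) 0 < \<epsilon>" by simp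
qed

section \<open>The singular support\<close>

text \<open>S need not be closed in the line, hence need not be complete in the usual distance. But
  open sets are completely metrizable and this passes to relatively closed subsets, so Baire applies
  in the topology of S.\<close>

lemma Baire_relatively_closed:
  fixes S U :: "real set" and T :: "nat \<Rightarrow> real set"
  assumes "open U" "closedin (top_of_set U) S" "S \<noteq> {}" "S \<subseteq> (\<Union>n. T n)"
    and "\<And>n. closedin (top_of_set S) (T n)"
  obtains n t r where "t \<in> S" "r > 0" "ball t r \<inter> S \<subseteq> T n"
proof -
  have "completely_metrizable_space (top_of_set U)"
    using completely_metrizable_space_openin[OF completely_metrizable_space_euclidean] assms(1) by simp
  from completely_metrizable_space_closedin[OF this assms(2)]
  have X: "completely_metrizable_space (top_of_set S)"
    using closedin_imp_subset[OF assms(2)] by (simp add: subtopology_subtopology Int_absorb1)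
  have "\<exists>n. top_of_set S interior_of T n \<noteq> {}"
  proof (rule ccontr)
    assume "\<not> ?thesis"
    then have "top_of_set S interior_of (\<Union>(range T)) = {}"
      using X assms(5) by (intro Baire_category_alt) auto
    moreover have "\<Union>(range T) = S"
      using assms(4,5) closedin_imp_subset by blast
    ultimately show False using assms(3) interior_of_topspace[of "top_of_set S"] by simp
  qed
  then obtain n t where "t \<in> top_of_set S interior_of T n" by blast
  then obtain G where G: "openin (top_of_set S) G" "t \<in> G" "G \<subseteq> T n" unfolding interior_of_def by blast
  then obtain V where V: "open V" "G = S \<inter> V" unfolding openin_open by blast
  then obtain r where r: "r > 0" "ball t r \<subseteq> V" using G(2) open_contains_ball by blast
  show ?thesis by (rule that[of t r n]) (use G V r in auto)
qed

lemma distribution_mono: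
  assumes "distribution U T" "W \<subseteq> U"
  shows "distribution W T"
proof -
  have sub: "test_funs W \<subseteq> test_funs U" using test_funs_mono[OF _ assms(2)] by blast
  have "linear_on (test_funs W) T"
    using assms(1) sub unfolding distribution_def linear_on_def by (meson subsetD)
  moreover have "\<exists>C N. \<forall>\<phi>\<in>test_funs W. tsupport \<phi> \<subseteq> K \<longrightarrow> norm (T \<phi>) \<le> C * (\<Sum>k\<le>N. supnorm_deriv k \<phi>)"
    if "compact K" "K \<subseteq> W" for K
  proof -
    have "K \<subseteq> U" using that assms(2) by blast
    then have "\<exists>C N. \<forall>\<phi>\<in>test_funs U. tsupport \<phi> \<subseteq> K \<longrightarrow> norm (T \<phi>) \<le> C * (\<Sum>k\<le>N. supnorm_deriv k \<phi>)"
      using assms(1) that(1) unfolding distribution_def by simp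
    then obtain C N where "\<forall>\<phi>\<in>test_funs U. tsupport \<phi> \<subseteq> K \<longrightarrow> norm (T \<phi>) \<le> C * (\<Sum>k\<le>N. supnorm_deriv k \<phi>)"
      by (elim exE) (rule that)
    then have "\<forall>\<phi>\<in>test_funs W. tsupport \<phi> \<subseteq> K \<longrightarrow> norm (T \<phi>) \<le> C * (\<Sum>k\<le>N. supnorm_deriv k \<phi>)"
      using sub by auto
    then show ?thesis by (intro exI)
  qed
  ultimately show ?thesis unfolding distribution_def by simp
qed

lemma closedin_sing_supp_PF: "closedin (top_of_set U) (sing_supp_PF U f)"
proof -
  have "open (\<Union>{V. open V \<and> V \<subseteq> U \<and> local_pseudofunction V f})" by (intro open_Union) auto
  then have "closed (- \<Union>{V. open V \<and> V \<subseteq> U \<and> local_pseudofunction V f})" by (simp only: closed_Compl)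
  then show ?thesis unfolding sing_supp_PF_def Diff_eq closedin_closed by blast
qed

lemma pf_near_outside_sing_supp:
  assumes "x \<in> U" "x \<notin> sing_supp_PF U f"
  shows "\<exists>W. x \<in> W \<and> pf_near f W"
proof -
  obtain V where "x \<in> V" "local_pseudofunction V f" using assms unfolding sing_supp_PF_def by auto
  then obtain W g where "open W" "x \<in> W" "pseudofunction g" "\<forall>\<phi>\<in>test_funs W. f \<phi> = g \<phi>"
    unfolding local_pseudofunction_def by meson
  then show ?thesis unfolding pf_near_def by blast
qed

text \<open>The one pseudofunction valid on W serves each of its points, with W itself as
  neighborhood.\<close>

lemma pf_near_not_in_sing_supp:
  assumes "distribution U f" "W \<subseteq> U" "x \<in> W" "pf_near f W"
  shows "x \<notin> sing_supp_PF U f"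
proof -
  have "open W" "local_pseudofunction W f"
    using assms(4) distribution_mono[OF assms(1,2)] unfolding local_pseudofunction_def pf_near_def by auto
  then show ?thesis using assms(2,3) unfolding sing_supp_PF_def by blast
qed

section \<open>Uniform control of the factorisations\<close>

definition ball_test_funs :: "real set \<Rightarrow> real \<Rightarrow> nat \<Rightarrow> testfun set" where
  "ball_test_funs U t0 n = test_funs (ball t0 (1 / real (Suc n)) \<inter> U)"

text \<open>One index is both constant and inverse radius: a larger n weakens the bound and shrinks
  the class of test functions, so countably many sets cover S.\<close>

definition controlled :: "real set \<Rightarrow> distr \<Rightarrow> nat \<Rightarrow> real set" where
  "controlled U f n = {t0. \<forall>\<phi>\<in>ball_test_funs U t0 n.
     norm (f \<phi>) \<le> real (Suc n) * wnorm (\<lambda>t. complex_of_real (t - t0) * \<phi> t)}"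

text \<open>A compact support inside an open ball stays inside after a small move of the center, and
  the right side is Lipschitz in t0 with a constant proportional to
  \<open>wnorm \<phi>\<close>.\<close>

lemma closed_controlled: "closed (controlled U f n)"
  unfolding closed_limpt
proof (intro allI impI)
  fix t0 assume lim: "t0 islimpt controlled U f n"
  define \<delta> where "\<delta> = 1 / real (Suc n)"
  have \<delta>: "\<delta> > 0" by (simp add: \<delta>_def)
  have "norm (f \<phi>) \<le> real (Suc n) * wnorm (\<lambda>t. complex_of_real (t - t0) * \<phi> t)"
    if "\<phi> \<in> ball_test_funs U t0 n" for \<phi>
  proof (rule field_le_epsilon)
    fix e :: real assume e: "e > 0"
    have p: "\<phi> \<in> test_funs (ball t0 \<delta> \<inter> U)" using that by (simp add: ball_test_funs_def \<delta>_def)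
    \<comment> \<open>Inserting t0 keeps the set nonempty when \<open>\<phi>\<close> vanishes
      identically.\<close>
    have "\<exists>x\<in>insert t0 (tsupport \<phi>). \<forall>y\<in>insert t0 (tsupport \<phi>). dist t0 y \<le> dist t0 x"
      by (rule continuous_attains_sup)
        (intro compact_insert test_funsD(2)[OF p] insert_not_empty continuous_intros)+
    then obtain x where x: "x \<in> insert t0 (tsupport \<phi>)" "\<And>y. y \<in> insert t0 (tsupport \<phi>) \<Longrightarrow> dist t0 y \<le> dist t0 x" by blast
    have "dist t0 x < \<delta>" using x(1) test_funsD(3)[OF p] \<delta> by auto
    \<comment> \<open>The first bound keeps the support in the ball about t1, the second keeps the
      change of the right side below e; the \<open>+ 1\<close> avoids division by 0.\<close>
    define \<eta> where "\<eta> = min (\<delta> - dist t0 x) (e / (real (Suc n) * (wnorm \<phi> + 1)))"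
    have w: "wnorm \<phi> + 1 > 0" using wnorm_nonneg[of \<phi>] by linarith
    have "\<eta> > 0" using \<open>dist t0 x < \<delta>\<close> e w by (simp add: \<eta>_def)
    then obtain t1 where t1: "t1 \<in> controlled U f n" "dist t1 t0 < \<eta>" using lim unfolding islimpt_approachable by blast
    have "\<phi> \<in> ball_test_funs U t1 n"
      unfolding ball_test_funs_def \<delta>_def[symmetric]
    proof (rule test_funsI[OF test_funsD(1,2)[OF p]])
      show "tsupport \<phi> \<subseteq> ball t1 \<delta> \<inter> U"
      proof
        fix y assume y: "y \<in> tsupport \<phi>"
        have "dist t1 y \<le> dist t1 t0 + dist t0 y" by (rule dist_triangle)
        also have "\<dots> < (\<delta> - dist t0 x) + dist t0 x"
          using t1(2) x(2)[of y] y by (intro add_less_le_mono) (auto simp: \<eta>_def)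
        finally show "y \<in> ball t1 \<delta> \<inter> U" using y test_funsD(3)[OF p] by auto
      qed
      show "y \<in> tsupport \<phi>" if "\<phi> y \<noteq> 0" for y by (rule tsupport_nonzero[of \<phi>, OF that])
    qed
    then have "norm (f \<phi>) \<le> real (Suc n) * wnorm (\<lambda>t. complex_of_real (t - t1) * \<phi> t)"
      using t1(1) unfolding controlled_def by blast
    also have "(\<lambda>t. complex_of_real (t - t1) * \<phi> t) = (\<lambda>t. complex_of_real (t - t0) * \<phi> t + complex_of_real (t0 - t1) * \<phi> t)"
      by (simp add: algebra_simps)
    also have "wnorm \<dots> \<le> wnorm (\<lambda>t. complex_of_real (t - t0) * \<phi> t) + wnorm (\<lambda>t. complex_of_real (t0 - t1) * \<phi> t)"
      by (rule wnorm_add_le[OF test_funs_mult(2)[OF p smooth_sub_of_real] test_funs_cmult[OF p]])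
    also have "wnorm (\<lambda>t. complex_of_real (t0 - t1) * \<phi> t) = \<bar>t0 - t1\<bar> * wnorm \<phi>"
      by (simp only: wnorm_cmult norm_of_real)
    finally have "norm (f \<phi>) \<le> real (Suc n) * (wnorm (\<lambda>t. complex_of_real (t - t0) * \<phi> t) + \<bar>t0 - t1\<bar> * wnorm \<phi>)"
      by (simp add: mult_left_mono)
    moreover have "real (Suc n) * (\<bar>t0 - t1\<bar> * wnorm \<phi>) \<le> e"
    proof -
      have "\<bar>t0 - t1\<bar> * wnorm \<phi> \<le> e / (real (Suc n) * (wnorm \<phi> + 1)) * (wnorm \<phi> + 1)"
        using t1(2) w wnorm_nonneg[of \<phi>] by (intro mult_mono) (auto simp: \<eta>_def dist_real_def abs_minus_commute)
      also have "\<dots> = e / real (Suc n)" using w by simp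
      finally show ?thesis by (simp only: pos_le_divide_eq of_nat_0_less_iff zero_less_Suc mult.commute)
    qed
    ultimately show "norm (f \<phi>) \<le> real (Suc n) * wnorm (\<lambda>t. complex_of_real (t - t0) * \<phi> t) + e"
      by (simp only: distrib_left)
  qed
  then show "t0 \<in> controlled U f n" unfolding controlled_def by blast
qed

text \<open>Multiplication by t - t0 does not enlarge supports, so shrinking to W replaces the local
  pseudomeasure by a single global one.\<close>

lemma local_factorization:
  assumes "local_pseudomeasure V f0" "t0 \<in> V"
    and "\<forall>\<phi>\<in>test_funs V. f \<phi> = f0 (\<lambda>t. complex_of_real (t - t0) * \<phi> t)"
  obtains W g where "open W" "t0 \<in> W" "W \<subseteq> V" "pseudomeasure g"
    "\<And>\<phi>. \<phi> \<in> test_funs W \<Longrightarrow> f \<phi> = g (\<lambda>t. complex_of_real (t - t0) * \<phi> t)"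
proof -
  obtain W g where W: "open W" "t0 \<in> W" "W \<subseteq> V" "pseudomeasure g" "\<forall>\<phi>\<in>test_funs W. f0 \<phi> = g \<phi>"
    using assms(1,2) unfolding local_pseudomeasure_def by meson
  have "f \<phi> = g (\<lambda>t. complex_of_real (t - t0) * \<phi> t)" if p: "\<phi> \<in> test_funs W" for \<phi>
  proof -
    have "f \<phi> = f0 (\<lambda>t. complex_of_real (t - t0) * \<phi> t)"
      using assms(3) test_funs_mono[OF p W(3)] by (rule bspec)
    also have "\<dots> = g (\<lambda>t. complex_of_real (t - t0) * \<phi> t)"
      using W(5) test_funs_mult(2)[OF p smooth_sub_of_real] by (rule bspec)
    finally show ?thesis .
  qed
  from that[OF W(1-4) this] show ?thesis .
qed

lemma controlled_of_factorization:
  assumes "open W" "t0 \<in> W" "pseudomeasure g"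
    and f: "\<And>\<phi>. \<phi> \<in> test_funs W \<Longrightarrow> f \<phi> = g (\<lambda>t. complex_of_real (t - t0) * \<phi> t)"
  shows "\<exists>n. t0 \<in> controlled U f n"
proof -
  obtain F where "fourier_is_fun g F" using assms(3) unfolding pseudomeasure_def by blast
  then obtain C where C: "C \<ge> 0" "\<And>\<psi>. \<psi> \<in> test_funs UNIV \<Longrightarrow> norm (g \<psi>) \<le> C * wnorm \<psi>"
    using fourier_is_fun_bound by metis
  obtain e where e: "e > 0" "ball t0 e \<subseteq> W" using assms(1,2) open_contains_ball by blast
  obtain n0 :: nat where n0: "max C (1 / e) < real n0" using reals_Archimedean2 by blast
  have n: "C \<le> real (Suc n0)" "1 / real (Suc n0) \<le> e"
    using n0 e(1) by (auto simp: field_simps)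
  have "norm (f \<phi>) \<le> real (Suc n0) * wnorm (\<lambda>t. complex_of_real (t - t0) * \<phi> t)"
    if "\<phi> \<in> ball_test_funs U t0 n0" for \<phi>
  proof -
    have p: "\<phi> \<in> test_funs W"
      using that n(2) e(2) unfolding ball_test_funs_def by (elim test_funs_mono) auto
    have "norm (f \<phi>) \<le> C * wnorm (\<lambda>t. complex_of_real (t - t0) * \<phi> t)"
      unfolding f[OF p] by (rule C(2)[OF test_funs_UNIV[OF test_funs_mult(2)[OF p smooth_sub_of_real]]])
    also have "\<dots> \<le> real (Suc n0) * wnorm (\<lambda>t. complex_of_real (t - t0) * \<phi> t)"
      by (rule mult_right_mono[OF n(1) wnorm_nonneg])
    finally show ?thesis .
  qed
  then show ?thesis unfolding controlled_def by blast
qed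

text \<open>The factorisation at t1 only serves to make the cut-off f a pseudomeasure with an
  explicit Fourier transform; the decay of that transform comes from the control at all points of S
  nearby.\<close>

lemma pf_near_of_uniform_control:
  assumes dist: "distribution U f"
    and W: "open W" "t1 \<in> W" "W \<subseteq> U" and g: "pseudomeasure g"
    and f: "\<And>\<phi>. \<phi> \<in> test_funs W \<Longrightarrow> f \<phi> = g (\<lambda>t. complex_of_real (t - t1) * \<phi> t)"
    and null: "sing_supp_PF U f \<subseteq> E" "E \<in> null_sets lborel"
    and r: "r > 0" "ball t1 r \<inter> sing_supp_PF U f \<subseteq> controlled U f n"
  shows "\<exists>W'. t1 \<in> W' \<and> W' \<subseteq> U \<and> pf_near f W'"
proof -
  let ?S = "sing_supp_PF U f"
  obtain e where e: "e > 0" "ball t1 e \<subseteq> W" using W open_contains_ball by blast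
  \<comment> \<open>The halves keep the closed ball inside the controlled portion and inside W. The
    last bound gives 2 R < 1/(n + 1): what is supported in the ball is admissible for every t0 of
    K.\<close>
  define R where "R = min (min (r / 2) (e / 2)) (1 / (4 * real (Suc n)))"
  have R: "R > 0" "R < r" "R < e" "2 * R < 1 / real (Suc n)"
  proof -
    show "R > 0" using r e by (simp add: R_def)
    have "R \<le> r / 2" "R \<le> e / 2" by (auto simp: R_def)
    then show "R < r" "R < e" using r e by linarith+
    have "2 * R \<le> 2 * (1 / (4 * real (Suc n)))" unfolding R_def by linarith
    also have "\<dots> < 1 / real (Suc n)" by (simp add: field_simps)
    finally show "2 * R < 1 / real (Suc n)" .
  qed
  have cbW: "cball t1 R \<subseteq> W" using R(3) e(2) by (force simp: subset_iff)
  let ?\<kappa> = "cutoff t1 R"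
  have kW: "?\<kappa> \<in> test_funs W" by (rule cutoff_test_funs[OF R(1) cbW])
  have kU: "?\<kappa> \<in> test_funs U" by (rule test_funs_mono[OF kW W(3)])
  have ks: "tsupport ?\<kappa> \<subseteq> cball t1 R"
  proof (rule tsupport_subsetI)
    show "x \<in> cball t1 R" if "?\<kappa> x \<noteq> 0" for x
      using that cutoff_eq_0[OF R(1), of x t1] by (force simp: dist_real_def abs_minus_commute)
  qed simp
  obtain C where C: "closed C" "?S = U \<inter> C" using closedin_sing_supp_PF[of U f] unfolding closedin_closed by blast
  define K where "K = ?S \<inter> cball t1 R"
  \<comment> \<open>S is closed only relative to U, but the closed ball lies inside U, so the
    portion is compact.\<close>
  have "K = C \<inter> cball t1 R" using C(2) cbW W(3) by (auto simp: K_def)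
  then have K: "compact K" using C(1) closed_Int_compact by auto
  have "K \<subseteq> E" using null(1) by (auto simp: K_def)
  then have Kn: "K \<in> null_sets lborel" using null_sets_subset[OF null(2), of K] compact_imp_closed[OF K] by auto
  have lim: "((\<lambda>h. f (\<lambda>t. ?\<kappa> t * kern (h * t))) \<longlongrightarrow> 0) at_infinity"
  proof (rule kern_mult_tendsto_zero[OF distribution_linear_on[OF dist] kU K Kn, where M = "real (Suc n)"])
    fix t0 \<phi> assume t0: "t0 \<in> K" and p: "\<phi> \<in> test_funs U" "tsupport \<phi> \<subseteq> tsupport ?\<kappa>"
    have "t0 \<in> controlled U f n" using t0 r(2) R(2) by (auto simp: K_def)
    moreover have "\<phi> \<in> ball_test_funs U t0 n"
    proof -
      have "tsupport \<phi> \<subseteq> ball t0 (1 / real (Suc n))"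
      proof
        fix x assume "x \<in> tsupport \<phi>"
        then have "dist t1 x \<le> R" using p(2) ks by auto
        moreover have "dist t1 t0 \<le> R" using t0 by (simp add: K_def)
        ultimately have "dist t0 x \<le> R + R" by (metis add_mono dist_commute dist_triangle order_trans)
        then show "x \<in> ball t0 (1 / real (Suc n))" using R(4) unfolding mem_ball by linarith
      qed
      then show ?thesis using p(1) by (auto simp: ball_test_funs_def test_funs_def)
    qed
    ultimately show "norm (f \<phi>) \<le> real (Suc n) * wnorm (\<lambda>t. complex_of_real (t - t0) * \<phi> t)"
      unfolding controlled_def by blast
  next
    fix x assume "x \<in> tsupport ?\<kappa>" "x \<notin> K"
    then have "x \<in> U" "x \<notin> ?S" using ks cbW W(3) by (auto simp: K_def)
    then show "\<exists>W. x \<in> W \<and> pf_near f W" by (rule pf_near_outside_sing_supp)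
  qed simp
  \<comment> \<open>With this \<open>\<theta>\<close> the cutoff times f is \<open>\<theta>\<close>
    times g, and its transform at h is the quantity just shown to vanish at infinity.\<close>
  define \<theta> :: testfun where "\<theta> t = complex_of_real (t - t1) * ?\<kappa> t" for t
  have th: "\<theta> \<in> test_funs UNIV"
    unfolding \<theta>_def[abs_def] by (rule test_funs_UNIV[OF test_funs_mult(2)[OF kW smooth_sub_of_real]])
  have F: "g (\<lambda>t. \<theta> t * kern (h * t)) = f (\<lambda>t. ?\<kappa> t * kern (h * t))" for h
    unfolding f[OF test_funs_mult(1)[OF kW smooth_kern]] \<theta>_def mult.assoc ..
  have "pseudofunction (\<lambda>\<phi>. g (\<lambda>t. \<theta> t * \<phi> t))"
    unfolding pseudofunction_def
    using pseudomeasure_mult_test_fun[OF g th] lim unfolding F by blast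
  \<comment> \<open>On the half ball the cutoff equals 1, so there \<open>\<theta>\<close> times g
    is f itself.\<close>
  moreover have "f \<phi> = g (\<lambda>t. \<theta> t * \<phi> t)" if p: "\<phi> \<in> test_funs (ball t1 (R / 2))" for \<phi>
  proof -
    have pW: "\<phi> \<in> test_funs W" using p cbW R(1) by (elim test_funs_mono) (auto simp: subset_iff)
    have e: "\<theta> t * \<phi> t = complex_of_real (t - t1) * \<phi> t" for t
    proof (cases "\<phi> t = 0")
      case False
      then have "t \<in> ball t1 (R / 2)" using tsupport_nonzero[of \<phi> t] test_funsD(3)[OF p] by blast
      then have "?\<kappa> t = 1" by (intro cutoff_eq_1[OF R(1)]) (simp add: dist_real_def abs_minus_commute)
      then show ?thesis by (simp add: \<theta>_def)
    qed simp
    show ?thesis unfolding f[OF pW] e ..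
  qed
  ultimately have "pf_near f (ball t1 (R / 2))" unfolding pf_near_def by blast
  moreover have "t1 \<in> ball t1 (R / 2)" "ball t1 (R / 2) \<subseteq> U" using R(1) cbW W(3) by (auto simp: subset_iff)
  ultimately show ?thesis by blast
qed

theorem theorem4p1:
  fixes U E :: "real set" and f :: distr
  assumes "open U"
    and "distribution U f"
    and "closedin (top_of_set U) E" and "E \<subseteq> U" and "E \<in> null_sets lborel"
    and "sing_supp_PF U f \<subseteq> E"
    and "\<forall>t0\<in>E. \<exists>V ft0. open V \<and> t0 \<in> V \<and> V \<subseteq> U \<and> local_pseudomeasure V ft0 \<and>
            (\<forall>\<phi>\<in>test_funs V. f \<phi> = ft0 (\<lambda>t. complex_of_real (t - t0) * \<phi> t))"
  shows "sing_supp_PF U f = {}"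
proof (rule ccontr)
  let ?S = "sing_supp_PF U f"
  assume ne: "?S \<noteq> {}"
  have fact: "\<exists>W g. open W \<and> t0 \<in> W \<and> W \<subseteq> U \<and> pseudomeasure g \<and>
      (\<forall>\<phi>\<in>test_funs W. f \<phi> = g (\<lambda>t. complex_of_real (t - t0) * \<phi> t))" if "t0 \<in> ?S" for t0
  proof -
    have "t0 \<in> E" using that assms(6) by blast
    from bspec[OF assms(7) this] obtain V f0 where V: "t0 \<in> V" "V \<subseteq> U" "local_pseudomeasure V f0"
      "\<forall>\<phi>\<in>test_funs V. f \<phi> = f0 (\<lambda>t. complex_of_real (t - t0) * \<phi> t)" by blast
    obtain W g where "open W" "t0 \<in> W" "W \<subseteq> V" "pseudomeasure g"
      "\<And>\<phi>. \<phi> \<in> test_funs W \<Longrightarrow> f \<phi> = g (\<lambda>t. complex_of_real (t - t0) * \<phi> t)"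
      by (rule local_factorization[OF V(3,1,4)]) (rule that)
    with V(2) show ?thesis by (intro exI[of _ W] exI[of _ g]) auto
  qed
  have cover: "?S \<subseteq> (\<Union>n. ?S \<inter> controlled U f n)"
  proof
    fix t0 assume t0: "t0 \<in> ?S"
    from fact[OF this] obtain W g where "open W" "t0 \<in> W" "pseudomeasure g"
      "\<forall>\<phi>\<in>test_funs W. f \<phi> = g (\<lambda>t. complex_of_real (t - t0) * \<phi> t)" by blast
    then have "\<exists>n. t0 \<in> controlled U f n" by (intro controlled_of_factorization[of W t0 g]) auto
    then show "t0 \<in> (\<Union>n. ?S \<inter> controlled U f n)" using t0 by blast
  qed
  obtain n t1 r where t1: "t1 \<in> ?S" and r: "r > 0" "ball t1 r \<inter> ?S \<subseteq> ?S \<inter> controlled U f n"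
    by (rule Baire_relatively_closed[OF assms(1) closedin_sing_supp_PF ne cover])
      (auto intro: closedin_closed_Int closed_controlled)
  obtain W g where W: "open W" "t1 \<in> W" "W \<subseteq> U" "pseudomeasure g"
    "\<forall>\<phi>\<in>test_funs W. f \<phi> = g (\<lambda>t. complex_of_real (t - t1) * \<phi> t)" using fact[OF t1] by blast
  have "\<exists>W'. t1 \<in> W' \<and> W' \<subseteq> U \<and> pf_near f W'"
    by (rule pf_near_of_uniform_control[OF assms(2) W(1-4) _ assms(6,5) r(1)]) (use W(5) r(2) in auto)
  then show False using pf_near_not_in_sing_supp[OF assms(2)] t1 by blast
qed

end
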